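(* Assume (A) $f$ and $g$ are continuous and $\rho$-weakly convex on $X$; (B) $f_{lb}=\inf_{x\in X}f(x)>-\infty$ and $g_{lb}=\inf_{x\in X}g(x)>-\infty$; (C) for any $x\in X$ one can compute $\zeta_f\in\partial f(x)$ and $\zeta_g\in\partial g(x)$ with $\|\zeta_f\|,\|\zeta_g\|\le M$; (D) a feasible point $x_0$ is known, i.e. $x_0\in X$ and $g(x_0)\le 0$; (E) for a constant $\sigma>0$, the $\sigma$-strong MFCQ condition is satisfied for any proximal subproblem $(P_k)$ of the method below. Let $\hat\rho>\max\{\rho,1\}$ be arbitrary, $\epsilon>0$, $D=\sqrt{(-8g_{lb})/(\hat\rho-\rho)}$, $B=\frac{M+\hat\rho D}{\sigma}$, and $$\tau_{KKT}=\frac{(\hat\rho-\rho)\epsilon^2}{4(1+B)^2\hat\rho(2\hat\rho-\rho)},$$ $$T_{KKT}=\max\left\{\frac{96(1+B)^2\hat\rho(2\hat\rho-\rho)(3M^2-2\hat\rho g_{lb})}{(\hat\rho-\rho)^2\epsilon^2},\sqrt{\frac{288(1+B)^2\hat\rho^3(2\hat\rho-\rho)D^2}{(\hat\rho-\rho)^2\epsilon^2}}\right\}=:\max\left\{\frac{\Lambda_1}{\epsilon^2},\frac{\Lambda_2}{\epsilon}\right\}.$$ Then the Proximally Guided Switching Subgradient Method started at $x_0$ with $\tau=\tau_{KKT}$ and $T_{inner}=T_{KKT}$ has $x_K$ be an $(\epsilon,\epsilon)$-KKT point of the problem $\min_{x\in X} f(x)$ s.t. $g(x)\le 0$, for some $$K\le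 \frac{4(1+B)\hat\rho^2(f(x_0)-f_{lb})}{(\hat\rho-\rho)\epsilon^2}=:\frac{\Lambda_3}{\epsilon^2}.$$ Such an $x_K$ is found using at most $\frac{\Lambda_3\max\{\Lambda_1,\Lambda_2\epsilon\}}{\epsilon^4}$ total subgradient evaluations (of either the objective or the constraint).
   Context: Norms are Euclidean. $X\subseteq\mathbb{R}^d$ is closed and convex, $f:X\to\mathbb{R}$, and $g=\max_{i=1,\dots,m}g_i$ for constraint functions $g_i:X\to\mathbb{R}$, treated as a single constraint; $\rho$ and $M$ are constants. $N_X(x)$ is the normal cone of $X$ at $x$, and $N_X^*(x)=\{v: v^Tn\ge0\ \forall n\in N_X(x)\}$ its dual cone; $\mathrm{dist}(x,S)=\min_{s\in S}\|x-s\|$. Subgradients: for convex $h$, $\partial h(x)=\{\zeta: h(x')\ge h(x)+\zeta^T(x'-x)\ \forall x'\in X\}$; for a possibly nonconvex $h$, $\partial h(x)$ is the Clarke subdifferential, the convex hull of all limits $\lim_i\nabla h(x_i)$ with $x_i\to x$, $x_i\in X$, $h$ differentiable at $x_i$. A function $h$ is $\rho$-weakly convex on $X$ if $h+\frac{\rho}{2}\|\cdot\|^2$ is convex on $X$; equivalently $h(x')\ge h(x)+\zeta^T(x'-x)-\frac{\rho}{2}\|x'-x\|^2$ for all $x,x'\in X$, $\zeta\in\partial h(x)$. Stationarity: $x\in X$ is an $\epsilon$-KKT point of $\min_{x\in X}f(x)$ s.t. $g(x)\le0$ if $g(x)\le 0$ and there exist $\zeta_f\in\partial f(x)$, $\zeta_g\in\partial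 g(x)$, $\lambda\ge0$ with $\mathrm{dist}(\zeta_f+\lambda\zeta_g,-N_X(x))\le\epsilon$ and $|\lambda g(x)|\le\epsilon^2$. A feasible point $x$ ($x\in X$, $g(x)\le0$) is an $(\epsilon,\eta)$-KKT point if there is an $\epsilon$-KKT point $x'$ with $\|x-x'\|\le\eta$. Switching subgradient method $SSM(\tau,T,z_0,\{\alpha_t\})$ for $\min_{z\in Z}F(z)$ s.t. $G(z)\le0$: start with $I=J=\emptyset$. For $t=0,\dots,T-1$: if $G(z_t)\le\tau$, set $z_{t+1}=\mathrm{proj}_Z(z_t-\alpha_t\zeta_{Ft})$ with $\zeta_{Ft}\in\partial F(z_t)$ and add $t$ to $I$; otherwise set $z_{t+1}=\mathrm{proj}_Z(z_t-\alpha_t\zeta_{Gt})$ with $\zeta_{Gt}\in\partial G(z_t)$ and add $t$ to $J$. Output $\bar z_T=\frac{\sum_{t\in I}(t+1)z_t}{\sum_{t\in I}(t+1)}$. Each step uses one subgradient evaluation. Proximally Guided Switching Subgradient Method (inputs $\hat\rho>\max\{\rho,1\}$, $\tau>0$, $T_{inner}$, $x_0\in X$ with $g(x_0)\le0$): set $\alpha_t=\frac{2}{(\hat\rho-\rho)(t+2)+\frac{36\hat\rho^2}{(\hat\rho-\rho)(t+1)}}$; for $k=0,1,\dots$ let $x_{k+1}$ be the output of $SSM(\tau,T_{inner},x_k,\{\alpha_t\})$ applied, with $Z=X$, to the subproblem $(P_k)$ of minimizing $F_k(x)=f(x)+\frac{\hat\rho}{2}\|x-x_k\|^2$ over $x\in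 X$ subject to $G_k(x)=g(x)+\frac{\hat\rho}{2}\|x-x_k\|^2\le 0$. The subgradients used are $\zeta_f+\hat\rho(z-x_k)\in\partial F_k(z)$ and $\zeta_g+\hat\rho(z-x_k)\in\partial G_k(z)$ with $\zeta_f,\zeta_g$ the subgradients of $f,g$ at $z$ of norm at most $M$ from assumption (C). $\sigma$-strong MFCQ for $(P_k)$: for every $x\in X$ there is $v\in-N_X^*(x)$ with $\|v\|=1$ such that, if $G_k(x)=0$, then $\zeta^Tv\le-\sigma$ for all $\zeta\in\partial G_k(x)$. *)

theory Defs
  imports "HOL-Analysis.Analysis"
begin

section \<open>Weak convexity, cones and subdifferentials\<close>

text \<open>
  A function on a set X is a total function of which only the values on X matter.
\<close>

definition weakly_convex_on :: "real \<Rightarrow> 'a::real_inner set \<Rightarrow> ('a \<Rightarrow> real) \<Rightarrow> bool" where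
  "weakly_convex_on \<rho> X h \<longleftrightarrow> convex_on X (\<lambda>x. h x + \<rho> / 2 * (norm x)\<^sup>2)"

definition normal_cone :: "'a::real_inner set \<Rightarrow> 'a \<Rightarrow> 'a set" where
  "normal_cone X x = {n. \<forall>y\<in>X. n \<bullet> (y - x) \<le> 0}"

definition dual_cone :: "'a::real_inner set \<Rightarrow> 'a set" where
  "dual_cone N = {v. \<forall>n\<in>N. v \<bullet> n \<ge> 0}"

definition convex_subdiff :: "'a::real_inner set \<Rightarrow> ('a \<Rightarrow> real) \<Rightarrow> 'a \<Rightarrow> 'a set" where
  "convex_subdiff X h x = {\<zeta>. \<forall>y\<in>X. h y \<ge> h x + \<zeta> \<bullet> (y - x)}"

text \<open>
  The derivatives are taken within X, because h is a function on X only: its values outside X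
  must not enter.  If X has nonempty interior, the gradient at a point where h is differentiable
  within X is unique, and at interior points it is the ordinary gradient.
\<close>

definition clarke_subdiff :: "'a::real_inner set \<Rightarrow> ('a \<Rightarrow> real) \<Rightarrow> 'a \<Rightarrow> 'a set" where
  "clarke_subdiff X h x = convex hull
     {\<zeta>. \<exists>u s. (\<forall>i::nat. u i \<in> X \<and> (h has_derivative (\<lambda>y. s i \<bullet> y)) (at (u i) within X))
               \<and> u \<longlonglongrightarrow> x \<and> s \<longlonglongrightarrow> \<zeta>}"

text \<open>
  On the boundary of X the two notions differ even for convex h: the first one contains all
  translates by normal vectors of X.  Convex functions use the first one, all others the second.
\<close>

definition subdiff :: "'a::real_inner set \<Rightarrow> ('a \<Rightarrow> real) \<Rightarrow> 'a \<Rightarrow> 'a set" where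
  "subdiff X h x = (if convex_on X h then convex_subdiff X h x else clarke_subdiff X h x)"

section \<open>Stationarity and constraint qualification\<close>

definition kkt_point ::
    "'a::real_inner set \<Rightarrow> ('a \<Rightarrow> real) \<Rightarrow> ('a \<Rightarrow> real) \<Rightarrow> real \<Rightarrow> 'a \<Rightarrow> bool" where
  "kkt_point X f g \<epsilon> x \<longleftrightarrow> x \<in> X \<and> g x \<le> 0 \<and>
     (\<exists>\<zeta>f \<in> subdiff X f x. \<exists>\<zeta>g \<in> subdiff X g x. \<exists>l \<ge> 0.
        infdist (\<zeta>f + l *\<^sub>R \<zeta>g) (uminus ` normal_cone X x) \<le> \<epsilon> \<and> \<bar>l * g x\<bar> \<le> \<epsilon>\<^sup>2)"

definition near_kkt_point ::
    "'a::real_inner set \<Rightarrow> ('a \<Rightarrow> real) \<Rightarrow> ('a \<Rightarrow> real) \<Rightarrow> real \<Rightarrow> real \<Rightarrow> 'a \<Rightarrow> bool" where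
  "near_kkt_point X f g \<epsilon> \<eta> x \<longleftrightarrow> x \<in> X \<and> g x \<le> 0 \<and>
     (\<exists>x'. kkt_point X f g \<epsilon> x' \<and> norm (x - x') \<le> \<eta>)"

definition strong_mfcq :: "real \<Rightarrow> 'a::real_inner set \<Rightarrow> ('a \<Rightarrow> real) \<Rightarrow> bool" where
  "strong_mfcq \<sigma> X G \<longleftrightarrow>
     (\<forall>x\<in>X. \<exists>v \<in> uminus ` dual_cone (normal_cone X x). norm v = 1 \<and>
        (G x = 0 \<longrightarrow> (\<forall>\<zeta> \<in> subdiff X G x. \<zeta> \<bullet> v \<le> - \<sigma>)))"

section \<open>The switching subgradient method\<close>

text \<open>
  The objective enters only through its subgradients.  The functions \<open>dF\<close> and \<open>dG\<close> give the
  subgradient of the objective and of the constraint G that is used if the method is at z in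
  step t; the choice may depend on t, so it need not be the same on every visit to z.
\<close>

primrec ssm_iter :: "'a::euclidean_space set \<Rightarrow> (nat \<Rightarrow> 'a \<Rightarrow> 'a) \<Rightarrow> ('a \<Rightarrow> real) \<Rightarrow> (nat \<Rightarrow> 'a \<Rightarrow> 'a)
    \<Rightarrow> real \<Rightarrow> (nat \<Rightarrow> real) \<Rightarrow> 'a \<Rightarrow> nat \<Rightarrow> 'a" where
  "ssm_iter Z dF G dG \<tau> \<alpha> z0 0 = z0"
| "ssm_iter Z dF G dG \<tau> \<alpha> z0 (Suc t) =
     (let z = ssm_iter Z dF G dG \<tau> \<alpha> z0 t
      in if G z \<le> \<tau> then closest_point Z (z - \<alpha> t *\<^sub>R dF t z)
         else closest_point Z (z - \<alpha> t *\<^sub>R dG t z))"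

definition ssm_I :: "'a::euclidean_space set \<Rightarrow> (nat \<Rightarrow> 'a \<Rightarrow> 'a) \<Rightarrow> ('a \<Rightarrow> real) \<Rightarrow> (nat \<Rightarrow> 'a \<Rightarrow> 'a)
    \<Rightarrow> real \<Rightarrow> nat \<Rightarrow> (nat \<Rightarrow> real) \<Rightarrow> 'a \<Rightarrow> nat set" where
  "ssm_I Z dF G dG \<tau> T \<alpha> z0 = {t. t < T \<and> G (ssm_iter Z dF G dG \<tau> \<alpha> z0 t) \<le> \<tau>}"

definition ssm_J :: "'a::euclidean_space set \<Rightarrow> (nat \<Rightarrow> 'a \<Rightarrow> 'a) \<Rightarrow> ('a \<Rightarrow> real) \<Rightarrow> (nat \<Rightarrow> 'a \<Rightarrow> 'a)
    \<Rightarrow> real \<Rightarrow> nat \<Rightarrow> (nat \<Rightarrow> real) \<Rightarrow> 'a \<Rightarrow> nat set" where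
  "ssm_J Z dF G dG \<tau> T \<alpha> z0 = {t. t < T \<and> \<not> G (ssm_iter Z dF G dG \<tau> \<alpha> z0 t) \<le> \<tau>}"

definition ssm_out :: "'a::euclidean_space set \<Rightarrow> (nat \<Rightarrow> 'a \<Rightarrow> 'a) \<Rightarrow> ('a \<Rightarrow> real) \<Rightarrow> (nat \<Rightarrow> 'a \<Rightarrow> 'a)
    \<Rightarrow> real \<Rightarrow> nat \<Rightarrow> (nat \<Rightarrow> real) \<Rightarrow> 'a \<Rightarrow> 'a" where
  "ssm_out Z dF G dG \<tau> T \<alpha> z0 =
     (\<Sum>t \<in> ssm_I Z dF G dG \<tau> T \<alpha> z0. real (t + 1) *\<^sub>R ssm_iter Z dF G dG \<tau> \<alpha> z0 t)
       /\<^sub>R (\<Sum>t \<in> ssm_I Z dF G dG \<tau> T \<alpha> z0. real (t + 1))"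

text \<open>One objective subgradient per step in I and one constraint subgradient per step in J.\<close>

definition ssm_evals :: "'a::euclidean_space set \<Rightarrow> (nat \<Rightarrow> 'a \<Rightarrow> 'a) \<Rightarrow> ('a \<Rightarrow> real) \<Rightarrow> (nat \<Rightarrow> 'a \<Rightarrow> 'a)
    \<Rightarrow> real \<Rightarrow> nat \<Rightarrow> (nat \<Rightarrow> real) \<Rightarrow> 'a \<Rightarrow> nat" where
  "ssm_evals Z dF G dG \<tau> T \<alpha> z0 =
     card (ssm_I Z dF G dG \<tau> T \<alpha> z0) + card (ssm_J Z dF G dG \<tau> T \<alpha> z0)"

section \<open>The proximally guided switching subgradient method\<close>

definition prox_fun :: "real \<Rightarrow> ('a::real_inner \<Rightarrow> real) \<Rightarrow> 'a \<Rightarrow> 'a \<Rightarrow> real" where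
  "prox_fun \<rho>h h c x = h x + \<rho>h / 2 * (norm (x - c))\<^sup>2"

text \<open>Subgradients of \<open>prox_fun \<rho>h h c\<close> made from subgradients \<open>s\<close> of \<open>h\<close>.\<close>

definition prox_grad :: "real \<Rightarrow> (nat \<Rightarrow> 'a::real_inner \<Rightarrow> 'a) \<Rightarrow> 'a \<Rightarrow> nat \<Rightarrow> 'a \<Rightarrow> 'a" where
  "prox_grad \<rho>h s c t z = s t z + \<rho>h *\<^sub>R (z - c)"

definition pg_step :: "real \<Rightarrow> real \<Rightarrow> nat \<Rightarrow> real" where
  "pg_step \<rho> \<rho>h t =
     2 / ((\<rho>h - \<rho>) * (real t + 2) + 36 * \<rho>h\<^sup>2 / ((\<rho>h - \<rho>) * (real t + 1)))"

text \<open>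
  \<open>sf k t z\<close> and \<open>sg k t z\<close> are the subgradients of the objective and of the constraint g
  obtained at z in step t of the subproblem with index k.
\<close>

primrec pgssm :: "'a::euclidean_space set \<Rightarrow> ('a \<Rightarrow> real) \<Rightarrow> (nat \<Rightarrow> nat \<Rightarrow> 'a \<Rightarrow> 'a)
    \<Rightarrow> (nat \<Rightarrow> nat \<Rightarrow> 'a \<Rightarrow> 'a) \<Rightarrow> real \<Rightarrow> real \<Rightarrow> real \<Rightarrow> nat \<Rightarrow> 'a \<Rightarrow> nat \<Rightarrow> 'a" where
  "pgssm X g sf sg \<rho> \<rho>h \<tau> T x0 0 = x0"
| "pgssm X g sf sg \<rho> \<rho>h \<tau> T x0 (Suc k) =
     (let c = pgssm X g sf sg \<rho> \<rho>h \<tau> T x0 k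
      in ssm_out X (prox_grad \<rho>h (sf k) c) (prox_fun \<rho>h g c) (prox_grad \<rho>h (sg k) c)
           \<tau> T (pg_step \<rho> \<rho>h) c)"

text \<open>Number of subgradients evaluated until the iterate with index \<open>K\<close> is computed.\<close>

definition pgssm_evals :: "'a::euclidean_space set \<Rightarrow> ('a \<Rightarrow> real) \<Rightarrow> (nat \<Rightarrow> nat \<Rightarrow> 'a \<Rightarrow> 'a)
    \<Rightarrow> (nat \<Rightarrow> nat \<Rightarrow> 'a \<Rightarrow> 'a) \<Rightarrow> real \<Rightarrow> real \<Rightarrow> real \<Rightarrow> nat \<Rightarrow> 'a \<Rightarrow> nat \<Rightarrow> nat" where
  "pgssm_evals X g sf sg \<rho> \<rho>h \<tau> T x0 K =
     (\<Sum>k<K. let c = pgssm X g sf sg \<rho> \<rho>h \<tau> T x0 k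
             in ssm_evals X (prox_grad \<rho>h (sf k) c) (prox_fun \<rho>h g c) (prox_grad \<rho>h (sg k) c)
                  \<tau> T (pg_step \<rho> \<rho>h) c)"

end

theory Submission
  imports Defs
begin

text \<open>
  One outer step moves from c towards the minimizer \<open>xh\<close> of the proximal subproblem with centre c.  Let l
  be the multiplier of \<open>xh\<close>.  The proximal terms are the only difference between stationarity in the
  subproblem and in the original problem, so c is nearly stationary unless \<open>(1 + l) * \<rho>h * norm (xh - c)\<close>
  exceeds \<open>\<epsilon>\<close> (lemma \<open>near_kkt_of_small_residual\<close>).  In that case the Lagrangian, which is strongly convex
  with a modulus proportional to \<open>1 + l\<close>, forces the optimal value of the subproblem below \<open>f c\<close> by a fixed
  amount (lemma \<open>ssm_progress\<close>).  The iterates also remain exactly feasible: the approximate solution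
  moves so far from c that its proximal term outweighs the tolerance \<open>\<tau>\<close>.  As f is bounded below, such
  steps must stop, and counting them bounds K.  The count is half of the bound that is claimed for K, and
  this slack pays for rounding the number of inner steps up to an integer.

  The inner problem is solved by the switching subgradient method (theorems \<open>ssm_weighted_gap\<close> and
  \<open>ssm_convergence\<close>).  The subgradients of the proximal functions may be unbounded, but their squared norm
  grows at most linearly in the constraint value.  In constraint steps this growth is absorbed by the
  progress of the step, and in objective steps the constraint value is at most \<open>\<tau>\<close>.

  The analytic part is to show that \<open>xh\<close> satisfies KKT conditions with Clarke subgradients, which for
  nonconvex f and g are limits of gradients and their convex combinations, also at the boundary of X and
  for X with empty interior.  A weakly convex function is differentiable within X at every point of
  the relative interior where a parabola touches it from above, and such points are dense (lemma
  \<open>differentiability_dense\<close>).  Gradients at such points near \<open>xh\<close> have limits that certify stationarity in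
  each single direction, and a separation argument yields one limit that serves all directions (lemmas
  \<open>minimax_normal_cone\<close> and \<open>stationarity_of_lagrangian_minimizer\<close>).  A Slater point and the bound
  \<open>l \<le> B\<close> both follow from pairing these conditions with the MFCQ direction (lemmas
  \<open>constraint_not_minimal\<close> and \<open>subproblem_solution\<close>).
\<close>

section \<open>Weakly convex functions and their subgradients\<close>

lemma norm_sq_affine_combination:
  fixes x y :: "'a::real_inner"
  shows "(norm ((1 - t) *\<^sub>R x + t *\<^sub>R y))\<^sup>2
     = (1 - t) * (norm x)\<^sup>2 + t * (norm y)\<^sup>2 - t * (1 - t) * (norm (x - y))\<^sup>2"
  unfolding power2_norm_eq_inner
  by (simp add: inner_diff inner_add inner_commute algebra_simps)

lemma norm_diff_sq:
  fixes x y :: "'a::real_inner"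
  shows "(norm (x - y))\<^sup>2 = (norm x)\<^sup>2 + (norm y)\<^sup>2 - 2 * (x \<bullet> y)"
  by (simp add: power2_norm_eq_inner inner_diff inner_commute)

lemma norm_add_sq:
  fixes x y :: "'a::real_inner"
  shows "(norm (x + y))\<^sup>2 = (norm x)\<^sup>2 + 2 * (x \<bullet> y) + (norm y)\<^sup>2"
  by (simp add: power2_norm_eq_inner inner_add inner_commute)

lemma weakly_convex_onD:
  fixes X :: "'a::real_inner set"
  assumes "weakly_convex_on r X h" "x \<in> X" "y \<in> X" "0 \<le> t" "t \<le> 1"
  shows "h ((1 - t) *\<^sub>R x + t *\<^sub>R y)
     \<le> (1 - t) * h x + t * h y + r / 2 * (t * (1 - t) * (norm (x - y))\<^sup>2)"
proof -
  have "h ((1 - t) *\<^sub>R x + t *\<^sub>R y) + r / 2 * (norm ((1 - t) *\<^sub>R x + t *\<^sub>R y))\<^sup>2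
      \<le> (1 - t) * (h x + r / 2 * (norm x)\<^sup>2) + t * (h y + r / 2 * (norm y)\<^sup>2)"
    using convex_onD[of X "\<lambda>x. h x + r / 2 * (norm x)\<^sup>2"] assms
    unfolding weakly_convex_on_def by blast
  then show ?thesis
    unfolding norm_sq_affine_combination by (simp add: field_simps)
qed

lemma weakly_convex_on_imp_convex: "weakly_convex_on r X h \<Longrightarrow> convex X"
  unfolding weakly_convex_on_def convex_on_def by blast

lemma weakly_convex_on_nonpos_imp_convex_on:
  fixes X :: "'a::real_inner set"
  assumes "weakly_convex_on r X h" "r \<le> 0"
  shows "convex_on X h"
proof (rule convex_onI)
  fix t :: real and x y
  assume t: "t > 0" "t < 1" and xy: "x \<in> X" "y \<in> X"
  have "r / 2 * (t * (1 - t) * (norm (x - y))\<^sup>2) \<le> 0"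
    using t assms(2) by (intro mult_nonpos_nonneg mult_nonneg_nonneg) auto
  then show "h ((1 - t) *\<^sub>R x + t *\<^sub>R y) \<le> (1 - t) * h x + t * h y"
    using weakly_convex_onD[OF assms(1) xy, of t] t by linarith
qed (rule weakly_convex_on_imp_convex[OF assms(1)])

lemma weakly_convex_on_lagrangian:
  assumes "weakly_convex_on r X F" "weakly_convex_on r X G" "0 \<le> l"
  shows "weakly_convex_on ((1 + l) * r) X (\<lambda>y. F y + l * G y)"
proof -
  have "convex_on X (\<lambda>y. (F y + r / 2 * (norm y)\<^sup>2) + l * (G y + r / 2 * (norm y)\<^sup>2))"
    using convex_on_add[OF _ convex_on_cmul] assms unfolding weakly_convex_on_def by blast
  also have "(\<lambda>y. (F y + r / 2 * (norm y)\<^sup>2) + l * (G y + r / 2 * (norm y)\<^sup>2))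
      = (\<lambda>y. (F y + l * G y) + (1 + l) * r / 2 * (norm y)\<^sup>2)"
    by (auto simp: field_simps)
  finally show ?thesis unfolding weakly_convex_on_def .
qed

lemma weakly_convex_on_prox_fun:
  assumes "weakly_convex_on r X h"
  shows "weakly_convex_on (r - s) X (prox_fun s h c)"
proof -
  have lin: "convex_on X (\<lambda>x. s / 2 * (norm c)\<^sup>2 - s * (c \<bullet> x))"
  proof (rule convex_onI[OF _ weakly_convex_on_imp_convex[OF assms]])
    fix t :: real and x y
    have "k - s * (c \<bullet> ((1 - t) *\<^sub>R x + t *\<^sub>R y))
        = (1 - t) * (k - s * (c \<bullet> x)) + t * (k - s * (c \<bullet> y))" for k
      by (simp add: inner_add_right algebra_simps)
    then show "s / 2 * (norm c)\<^sup>2 - s * (c \<bullet> ((1 - t) *\<^sub>R x + t *\<^sub>R y))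
        \<le> (1 - t) * (s / 2 * (norm c)\<^sup>2 - s * (c \<bullet> x)) + t * (s / 2 * (norm c)\<^sup>2 - s * (c \<bullet> y))"
      by (rule eq_refl)
  qed
  have "convex_on X (\<lambda>x. (h x + r / 2 * (norm x)\<^sup>2) + (s / 2 * (norm c)\<^sup>2 - s * (c \<bullet> x)))"
    using convex_on_add[OF _ lin] assms unfolding weakly_convex_on_def by blast
  also have "(\<lambda>x. (h x + r / 2 * (norm x)\<^sup>2) + (s / 2 * (norm c)\<^sup>2 - s * (c \<bullet> x)))
      = (\<lambda>x. prox_fun s h c x + (r - s) / 2 * (norm x)\<^sup>2)"
  proof
    fix x
    have eq: "(norm (x - c))\<^sup>2 = (norm x)\<^sup>2 + (norm c)\<^sup>2 - 2 * (c \<bullet> x)"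
      by (simp add: norm_diff_sq inner_commute)
    show "(h x + r / 2 * (norm x)\<^sup>2) + (s / 2 * (norm c)\<^sup>2 - s * (c \<bullet> x))
        = prox_fun s h c x + (r - s) / 2 * (norm x)\<^sup>2"
      unfolding prox_fun_def eq by (simp add: field_simps)
  qed
  finally show ?thesis unfolding weakly_convex_on_def .
qed

text \<open>
  Both subdifferentials of a continuous r-weakly convex function lie in this set, which is why convex and
  nonconvex functions need no separate treatment below. A negative r expresses strong convexity.
\<close>
definition weak_subdiff :: "real \<Rightarrow> 'a::real_inner set \<Rightarrow> ('a \<Rightarrow> real) \<Rightarrow> 'a \<Rightarrow> 'a set" where
  "weak_subdiff r X h x =
     {\<zeta>. \<forall>y\<in>X. h y \<ge> h x + \<zeta> \<bullet> (y - x) - r / 2 * (norm (y - x))\<^sup>2}"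

lemma weak_subdiff_zero: "weak_subdiff 0 X h x = convex_subdiff X h x"
  by (simp add: weak_subdiff_def convex_subdiff_def)

lemma weak_subdiff_prox_fun:
  assumes "\<zeta> \<in> weak_subdiff r X h x"
  shows "\<zeta> + s *\<^sub>R (x - c) \<in> weak_subdiff (r - s) X (prox_fun s h c) x"
proof -
  have *: "s / 2 * (norm (y - c))\<^sup>2
      = s / 2 * (norm (x - c))\<^sup>2 + s * ((x - c) \<bullet> (y - x)) + s / 2 * (norm (y - x))\<^sup>2" for y
    using norm_add_sq[of "x - c" "y - x"] by (simp add: field_simps)
  show ?thesis
    unfolding weak_subdiff_def prox_fun_def
  proof (intro CollectI ballI)
    fix y assume "y \<in> X"
    then have "h y \<ge> h x + \<zeta> \<bullet> (y - x) - r / 2 * (norm (y - x))\<^sup>2"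
      using assms unfolding weak_subdiff_def by blast
    then have "h y + s / 2 * (norm (y - c))\<^sup>2
       \<ge> h x + s / 2 * (norm (x - c))\<^sup>2 + (\<zeta> \<bullet> (y - x) + s * ((x - c) \<bullet> (y - x)))
          - (r - s) / 2 * (norm (y - x))\<^sup>2"
      using *[of y] by (simp add: field_simps)
    then show "h y + s / 2 * (norm (y - c))\<^sup>2
       \<ge> h x + s / 2 * (norm (x - c))\<^sup>2 + (\<zeta> + s *\<^sub>R (x - c)) \<bullet> (y - x)
          - (r - s) / 2 * (norm (y - x))\<^sup>2"
      by (simp only: inner_add_left inner_scaleR_left)
  qed
qed

lemma convex_weak_subdiff: "convex (weak_subdiff r X h x)"
proof -
  have "weak_subdiff r X h x =
      (\<Inter>y\<in>X. {\<zeta>. (y - x) \<bullet> \<zeta> \<le> h y - h x + r / 2 * (norm (y - x))\<^sup>2})"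
    by (auto simp: weak_subdiff_def inner_commute algebra_simps)
  then show ?thesis by (simp add: convex_INT convex_halfspace_le)
qed

text \<open>
  First-order information along segments is enough: weak convexity bounds the difference quotient at t by
  the full difference plus the quadratic term, and t tends to 0. The inclusions for convex subgradients
  and for derivatives, and thereby quadratic growth at minimizers, are instances.
\<close>
lemma weak_subdiffI_directional:
  fixes X :: "'a::real_inner set"
  assumes wc: "weakly_convex_on r X h" and x: "x \<in> X"
    and dir: "\<And>y e. y \<in> X \<Longrightarrow> 0 < e \<Longrightarrow>
      \<forall>\<^sub>F t in at_right 0. h (x + t *\<^sub>R (y - x)) \<ge> h x + t * (\<zeta> \<bullet> (y - x)) - t * e"
  shows "\<zeta> \<in> weak_subdiff r X h x"
  unfolding weak_subdiff_def
proof (intro CollectI ballI)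
  fix y assume y: "y \<in> X"
  let ?n = "(norm (x - y))\<^sup>2"
  have "h y - h x - \<zeta> \<bullet> (y - x) + r / 2 * ?n + e \<ge> 0" if e: "0 < e" for e
  proof (rule tendsto_lowerbound)
    have "((\<lambda>t. h y - h x - \<zeta> \<bullet> (y - x) + r / 2 * ((1 - t) * ?n) + e) \<longlongrightarrow>
        h y - h x - \<zeta> \<bullet> (y - x) + r / 2 * ((1 - 0) * ?n) + e) (at_right 0)"
      by (intro tendsto_intros)
    then show "((\<lambda>t. h y - h x - \<zeta> \<bullet> (y - x) + r / 2 * ((1 - t) * ?n) + e) \<longlongrightarrow>
        h y - h x - \<zeta> \<bullet> (y - x) + r / 2 * ?n + e) (at_right 0)"
      by simp
  next
    show "\<forall>\<^sub>F t in at_right 0. 0 \<le> h y - h x - \<zeta> \<bullet> (y - x) + r / 2 * ((1 - t) * ?n) + e"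
      using dir[OF y e] eventually_at_right_less[of 0]
        eventually_at_right_real[of 0 "1::real", OF zero_less_one]
    proof eventually_elim
      case (elim t)
      have eq: "(1 - t) *\<^sub>R x + t *\<^sub>R y = x + t *\<^sub>R (y - x)"
        by (simp add: algebra_simps)
      have "h (x + t *\<^sub>R (y - x)) \<le> (1 - t) * h x + t * h y + r / 2 * (t * (1 - t) * ?n)"
        using weakly_convex_onD[OF wc x y, of t] elim unfolding eq by auto
      then have "0 \<le> t * (h y - h x - \<zeta> \<bullet> (y - x) + r / 2 * ((1 - t) * ?n) + e)"
        using elim(1) by (simp add: algebra_simps)
      then show ?case using elim(2) by (simp add: zero_le_mult_iff)
    qed
  qed simp
  then have "h y - h x - \<zeta> \<bullet> (y - x) + r / 2 * ?n \<ge> 0"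
    by (rule field_le_epsilon)
  then show "h x + \<zeta> \<bullet> (y - x) - r / 2 * (norm (y - x))\<^sup>2 \<le> h y"
    by (simp add: norm_minus_commute)
qed

lemma convex_subdiff_subset_weak_subdiff:
  assumes wc: "weakly_convex_on r X h" and x: "x \<in> X"
  shows "convex_subdiff X h x \<subseteq> weak_subdiff r X h x"
proof
  fix \<zeta> assume z: "\<zeta> \<in> convex_subdiff X h x"
  show "\<zeta> \<in> weak_subdiff r X h x"
  proof (rule weak_subdiffI_directional[OF wc x])
    fix y and e :: real assume y: "y \<in> X" and e: "0 < e"
    show "\<forall>\<^sub>F t in at_right 0. h (x + t *\<^sub>R (y - x)) \<ge> h x + t * (\<zeta> \<bullet> (y - x)) - t * e"
      using eventually_at_right_less[of 0] eventually_at_right_real[of 0 "1::real", OF zero_less_one]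
    proof eventually_elim
      case (elim t)
      have "(1 - t) *\<^sub>R x + t *\<^sub>R y \<in> X"
        using weakly_convex_on_imp_convex[OF wc] x y elim by (intro convexD_alt) auto
      then have "x + t *\<^sub>R (y - x) \<in> X"
        by (simp add: algebra_simps)
      then have "h (x + t *\<^sub>R (y - x)) \<ge> h x + \<zeta> \<bullet> (x + t *\<^sub>R (y - x) - x)"
        using z unfolding convex_subdiff_def by blast
      moreover have "t * e \<ge> 0" using e elim(1) by simp
      ultimately show ?case by (simp add: inner_scaleR_right)
    qed
  qed
qed

lemma derivative_in_weak_subdiff:
  assumes wc: "weakly_convex_on r X h" and x: "x \<in> X"
    and der: "(h has_derivative (\<lambda>y. \<zeta> \<bullet> y)) (at x within X)"
  shows "\<zeta> \<in> weak_subdiff r X h x"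
proof (rule weak_subdiffI_directional[OF wc x])
  fix y and e :: real assume y: "y \<in> X" and e: "0 < e"
  define e' where "e' = e / (norm (y - x) + 1)"
  have e': "e' > 0" and e'n: "e' * norm (y - x) \<le> e"
    using e unfolding e'_def by (auto simp: field_simps add_pos_nonneg)
  obtain d where d: "d > 0" and D: "\<And>z. z \<in> X \<Longrightarrow> norm (z - x) < d \<Longrightarrow>
      norm (h z - h x - \<zeta> \<bullet> (z - x)) \<le> e' * norm (z - x)"
    using der e' unfolding has_derivative_within_alt by blast
  have "d / (norm (y - x) + 1) > 0"
    using d by (simp add: add_nonneg_pos)
  show "\<forall>\<^sub>F t in at_right 0. h (x + t *\<^sub>R (y - x)) \<ge> h x + t * (\<zeta> \<bullet> (y - x)) - t * e"
    using eventually_at_right_less[of 0] eventually_at_right_real[of 0 "1::real", OF zero_less_one]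
      eventually_at_right_real[OF \<open>d / (norm (y - x) + 1) > 0\<close>]
  proof eventually_elim
    case (elim t)
    have "(1 - t) *\<^sub>R x + t *\<^sub>R y \<in> X"
      using weakly_convex_on_imp_convex[OF wc] x y elim by (intro convexD_alt) auto
    then have inX: "x + t *\<^sub>R (y - x) \<in> X"
      by (simp add: algebra_simps)
    have "t * (norm (y - x) + 1) < d"
      using elim by (simp add: pos_less_divide_eq add_nonneg_pos)
    then have "t * norm (y - x) < d" using elim by (simp add: algebra_simps)
    then have "\<bar>h (x + t *\<^sub>R (y - x)) - h x - \<zeta> \<bullet> (t *\<^sub>R (y - x))\<bar> \<le> e' * (t * norm (y - x))"
      using D[OF inX] elim by simp
    also have "\<dots> = t * (e' * norm (y - x))" by simp
    also have "\<dots> \<le> t * e" using e'n elim(1) by (intro mult_left_mono) auto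
    finally show ?case by (simp add: inner_scaleR_right)
  qed
qed

lemma weak_subdiff_limit:
  assumes cont: "continuous_on X h" and x: "x \<in> X" and u: "\<And>i. u i \<in> X"
    and s: "\<And>i. s i \<in> weak_subdiff r X h (u i)"
    and ux: "u \<longlonglongrightarrow> x" and sz: "s \<longlonglongrightarrow> \<zeta>"
  shows "\<zeta> \<in> weak_subdiff r X h x"
  unfolding weak_subdiff_def
proof (intro CollectI ballI)
  fix y assume y: "y \<in> X"
  have "(\<lambda>i. h (u i)) \<longlonglongrightarrow> h x"
    using continuous_on_tendsto_compose[OF cont ux x] u by simp
  then have "(\<lambda>i. h (u i) + s i \<bullet> (y - u i) - r / 2 * (norm (y - u i))\<^sup>2)
      \<longlonglongrightarrow> h x + \<zeta> \<bullet> (y - x) - r / 2 * (norm (y - x))\<^sup>2"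
    by (intro tendsto_intros ux sz)
  then show "h x + \<zeta> \<bullet> (y - x) - r / 2 * (norm (y - x))\<^sup>2 \<le> h y"
    by (rule LIMSEQ_le_const2) (use s y in \<open>auto simp: weak_subdiff_def\<close>)
qed

lemma clarke_subdiff_subset_weak_subdiff:
  assumes wc: "weakly_convex_on r X h" and cont: "continuous_on X h" and x: "x \<in> X"
  shows "clarke_subdiff X h x \<subseteq> weak_subdiff r X h x"
  unfolding clarke_subdiff_def
proof (rule hull_minimal, safe)
  fix \<zeta> u s
  assume "\<forall>i::nat. u i \<in> X \<and> (h has_derivative (\<lambda>y. s i \<bullet> y)) (at (u i) within X)"
    and "u \<longlonglongrightarrow> x" "s \<longlonglongrightarrow> \<zeta>"
  then show "\<zeta> \<in> weak_subdiff r X h x"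
    by (intro weak_subdiff_limit[OF cont x, of u s]) (auto intro: derivative_in_weak_subdiff[OF wc])
qed (rule convex_weak_subdiff)

lemma subdiff_subset_weak_subdiff:
  assumes "weakly_convex_on r X h" "continuous_on X h" "x \<in> X"
  shows "subdiff X h x \<subseteq> weak_subdiff r X h x"
  using convex_subdiff_subset_weak_subdiff[OF assms(1,3)] clarke_subdiff_subset_weak_subdiff[OF assms]
  unfolding subdiff_def by presburger

text \<open>
  For a convex function the Clarke set is only a part of the convex one, which also contains all
  translates by normal vectors. It is therefore enough to find Clarke subgradients.
\<close>
lemma clarke_subdiff_subset_subdiff:
  assumes "continuous_on X h" "x \<in> X"
  shows "clarke_subdiff X h x \<subseteq> subdiff X h x"
proof (cases "convex_on X h")
  case True
  then have "weakly_convex_on 0 X h" by (simp add: weakly_convex_on_def)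
  from clarke_subdiff_subset_weak_subdiff[OF this assms] True show ?thesis
    by (simp add: subdiff_def weak_subdiff_zero)
qed (simp add: subdiff_def)

section \<open>Points of differentiability of a weakly convex function\<close>

text \<open>
  Between a weak subgradient below and a parabola above there is no room for a kink. In the relative
  interior both signs of every direction are available, so the two linear parts agree along X even if X
  has empty interior. Any weak subgradient at such a point is a derivative within X; hence so is the one
  that the method would use there.
\<close>
lemma has_derivative_of_parabola_above:
  fixes X :: "'a::euclidean_space set"
  assumes X: "convex X" and u: "u \<in> rel_interior X"
    and z: "\<zeta> \<in> weak_subdiff r X h u"
    and d: "d > 0" and above: "\<And>y. y \<in> X \<Longrightarrow> norm (y - u) < d \<Longrightarrow>
      h y \<le> h u + K * ((norm (y - p))\<^sup>2 - (norm (u - p))\<^sup>2)"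
  shows "(h has_derivative (\<lambda>y. \<zeta> \<bullet> y)) (at u within X)"
proof -
  define e where "e = (2 * K) *\<^sub>R (u - p) - \<zeta>"
  define C where "C = \<bar>K\<bar> + \<bar>r\<bar>"
  have uX: "u \<in> X" using u rel_interior_subset by blast
  have lower: "h y - h u - \<zeta> \<bullet> (y - u) \<ge> - C * (norm (y - u))\<^sup>2" if "y \<in> X" for y
  proof -
    have "h y \<ge> h u + \<zeta> \<bullet> (y - u) - r / 2 * (norm (y - u))\<^sup>2"
      using z that unfolding weak_subdiff_def by blast
    moreover have "r / 2 * (norm (y - u))\<^sup>2 \<le> C * (norm (y - u))\<^sup>2"
      unfolding C_def by (intro mult_right_mono) auto
    ultimately show ?thesis by linarith
  qed
  have upper: "h y - h u - \<zeta> \<bullet> (y - u) \<le> e \<bullet> (y - u) + C * (norm (y - u))\<^sup>2"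
    if "y \<in> X" "norm (y - u) < d" for y
  proof -
    have "(norm (y - p))\<^sup>2 - (norm (u - p))\<^sup>2 = 2 * ((u - p) \<bullet> (y - u)) + (norm (y - u))\<^sup>2"
      using norm_add_sq[of "u - p" "y - u"] by simp
    then have "h y \<le> h u + K * (2 * ((u - p) \<bullet> (y - u)) + (norm (y - u))\<^sup>2)"
      using above[OF that] by simp
    also have "\<dots> = h u + (e + \<zeta>) \<bullet> (y - u) + K * (norm (y - u))\<^sup>2"
      unfolding e_def by (simp add: inner_scaleR_left distrib_left)
    finally have "h y - h u - \<zeta> \<bullet> (y - u) \<le> e \<bullet> (y - u) + K * (norm (y - u))\<^sup>2"
      by (simp add: inner_add_left)
    moreover have "K * (norm (y - u))\<^sup>2 \<le> C * (norm (y - u))\<^sup>2"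
      unfolding C_def by (intro mult_right_mono) auto
    ultimately show ?thesis by linarith
  qed
  \<comment> \<open>The upper bound lies above the lower one; near u along a segment only the linear gap \<open>e\<close> survives.\<close>
  have nonneg: "e \<bullet> (y - u) \<ge> 0" if y: "y \<in> X" for y
  proof (rule field_le_epsilon)
    fix \<eta> :: real assume \<eta>: "\<eta> > 0"
    define n where "n = norm (y - u)"
    have "\<forall>\<^sub>F t in at_right 0. t * n < d" "\<forall>\<^sub>F t in at_right 0. 2 * C * t * n\<^sup>2 < \<eta>"
    proof -
      have "((\<lambda>t. t * n) \<longlongrightarrow> 0 * n) (at_right 0)" "((\<lambda>t. 2 * C * t * n\<^sup>2) \<longlongrightarrow> 2 * C * 0 * n\<^sup>2) (at_right 0)"
        by (intro tendsto_intros)+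
      then show "\<forall>\<^sub>F t in at_right 0. t * n < d" "\<forall>\<^sub>F t in at_right 0. 2 * C * t * n\<^sup>2 < \<eta>"
        using d \<eta> by (auto dest: order_tendstoD(2))
    qed
    then have "\<forall>\<^sub>F t in at_right (0::real). 0 \<le> e \<bullet> (y - u) + \<eta>"
      using eventually_at_right_less[of 0] eventually_at_right_real[of 0 "1::real", OF zero_less_one]
    proof eventually_elim
      case (elim t)
      define v where "v = u + t *\<^sub>R (y - u)"
      have "(1 - t) *\<^sub>R u + t *\<^sub>R y \<in> X"
        using X uX y elim by (intro convexD_alt) auto
      then have v: "v \<in> X" unfolding v_def by (simp add: algebra_simps)
      have nv: "norm (v - u) = t * n" using elim unfolding v_def n_def by simp
      have "0 \<le> e \<bullet> (v - u) + 2 * C * (norm (v - u))\<^sup>2"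
        using lower[OF v] upper[OF v] elim nv by auto
      also have "\<dots> = t * (e \<bullet> (y - u) + 2 * C * t * n\<^sup>2)"
        unfolding nv by (simp add: v_def power2_eq_square distrib_left)
      finally have "0 \<le> e \<bullet> (y - u) + 2 * C * t * n\<^sup>2"
        using elim by (simp add: zero_le_mult_iff)
      then show ?case using elim by linarith
    qed
    then show "0 \<le> e \<bullet> (y - u) + \<eta>" by (simp add: eventually_const trivial_limit_at_right_real)
  qed
  have zero: "e \<bullet> (y - u) = 0" if y: "y \<in> X" for y
  proof -
    obtain c where c: "c > 1" "(1 - c) *\<^sub>R y + c *\<^sub>R u \<in> X"
      using u y convex_rel_interior_iff[OF X] by (metis empty_iff)
    have "e \<bullet> (((1 - c) *\<^sub>R y + c *\<^sub>R u) - u) \<ge> 0" by (rule nonneg[OF c(2)])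
    also have "((1 - c) *\<^sub>R y + c *\<^sub>R u) - u = (1 - c) *\<^sub>R (y - u)" by (simp add: algebra_simps)
    finally have "(1 - c) * (e \<bullet> (y - u)) \<ge> 0" by simp
    then show ?thesis using nonneg[OF y] c(1) by (simp add: zero_le_mult_iff)
  qed
  show ?thesis
    unfolding has_derivative_within_alt
  proof (intro conjI allI impI bounded_linear_inner_right)
    fix \<epsilon> :: real assume \<epsilon>: "0 < \<epsilon>"
    have C: "C \<ge> 0" unfolding C_def by simp
    show "\<exists>d>0. \<forall>y\<in>X. norm (y - u) < d \<longrightarrow>
        norm (h y - h u - \<zeta> \<bullet> (y - u)) \<le> \<epsilon> * norm (y - u)"
    proof (intro exI conjI ballI impI)
      show "min d (\<epsilon> / (C + 1)) > 0" using d \<epsilon> C by simp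
      fix y assume y: "y \<in> X" and n: "norm (y - u) < min d (\<epsilon> / (C + 1))"
      have "norm (y - u) * (C + 1) \<le> \<epsilon>"
        using n C by (simp add: pos_less_divide_eq)
      then have "C * norm (y - u) + norm (y - u) \<le> \<epsilon>"
        by (simp add: algebra_simps)
      then have "C * norm (y - u) \<le> \<epsilon>"
        using norm_ge_zero[of "y - u"] by linarith
      then have "C * norm (y - u) * norm (y - u) \<le> \<epsilon> * norm (y - u)"
        by (intro mult_right_mono) auto
      moreover have "\<bar>h y - h u - \<zeta> \<bullet> (y - u)\<bar> \<le> C * (norm (y - u))\<^sup>2"
        using lower[OF y] upper[OF y] zero[OF y] n by auto
      ultimately show "norm (h y - h u - \<zeta> \<bullet> (y - u)) \<le> \<epsilon> * norm (y - u)"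
        by (simp add: power2_eq_square)
    qed
  qed
qed

text \<open>
  Maximizing h minus a steep parabola centred at p over a small ball gives a point near p at which a
  parabola touches h from above. This replaces almost-everywhere differentiability of convex functions:
  only density is used.
\<close>
lemma parabola_above_dense:
  fixes X :: "'a::euclidean_space set"
  assumes cont: "continuous_on X h" and p: "p \<in> rel_interior X" and e: "e > 0"
  obtains u K d where "u \<in> rel_interior X" "norm (u - p) < e" "d > 0"
    "\<And>y. y \<in> X \<Longrightarrow> norm (y - u) < d \<Longrightarrow> h y \<le> h u + K * ((norm (y - p))\<^sup>2 - (norm (u - p))\<^sup>2)"
proof -
  obtain e1 where e1: "e1 > 0" "cball p e1 \<inter> affine hull X \<subseteq> X" and pX: "p \<in> X"
    using p unfolding mem_rel_interior_cball by blast
  define q where "q = min (e1) (e / 2)"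
  define S where "S = cball p q \<inter> affine hull X"
  have q: "0 < q" "q < e" "q \<le> e1" using e1(1) e unfolding q_def by auto
  have SX: "S \<subseteq> X" using e1(2) q unfolding S_def by auto
  have S: "compact S" unfolding S_def by (intro compact_Int_closed) auto
  have pS: "p \<in> S" using q pX hull_subset[of X affine] unfolding S_def by auto
  have contS: "continuous_on S h" using continuous_on_subset[OF cont SX] .
  obtain b where b: "b \<in> S" "\<And>y. y \<in> S \<Longrightarrow> h y \<le> h b"
    using continuous_attains_sup[OF S _ contS] pS by blast
  \<comment> \<open>With this curvature the maximiser below cannot lie on the sphere of radius \<open>q\<close>.\<close>
  define K where "K = (h b - h p + 1) / q\<^sup>2"
  have "continuous_on S (\<lambda>y. h y - K * (norm (y - p))\<^sup>2)"
    by (intro continuous_intros contS)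
  then obtain u where u: "u \<in> S"
    and umax: "\<And>y. y \<in> S \<Longrightarrow> h y - K * (norm (y - p))\<^sup>2 \<le> h u - K * (norm (u - p))\<^sup>2"
    using continuous_attains_sup[OF S] pS by blast
  have "norm (u - p) \<noteq> q"
  proof
    assume "norm (u - p) = q"
    then have "K * (norm (u - p))\<^sup>2 = h b - h p + 1" using q by (simp add: K_def)
    then show False using umax[OF pS] b(2)[OF u] by simp
  qed
  moreover have "norm (u - p) \<le> q" using u unfolding S_def by (simp add: dist_norm norm_minus_commute)
  ultimately have uq: "norm (u - p) < q" by simp
  define d where "d = q - norm (u - p)"
  have d: "d > 0" using uq unfolding d_def by simp
  have inS: "y \<in> S" if "y \<in> affine hull X" "norm (y - u) < d" for y
  proof -
    have "norm (y - p) \<le> norm (y - u) + norm (u - p)" using norm_triangle_ineq[of "y - u" "u - p"] by simp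
    then show ?thesis using that unfolding S_def d_def by (simp add: dist_norm norm_minus_commute)
  qed
  show thesis
  proof (rule that[of u d K])
    have "ball u d \<inter> affine hull X \<subseteq> X"
      using inS SX by (auto simp: dist_norm norm_minus_commute)
    then show "u \<in> rel_interior X"
      unfolding mem_rel_interior_ball using u SX d by blast
    show "norm (u - p) < e" using uq q by simp
    show "d > 0" by (rule d)
    fix y assume "y \<in> X" "norm (y - u) < d"
    then have "y \<in> S" using inS hull_subset[of X affine] by blast
    from umax[OF this] show "h y \<le> h u + K * ((norm (y - p))\<^sup>2 - (norm (u - p))\<^sup>2)"
      by (simp add: algebra_simps)
  qed
qed

lemma differentiability_dense:
  fixes X :: "'a::euclidean_space set"
  assumes X: "convex X" and cont: "continuous_on X h"
    and s: "\<And>u. u \<in> X \<Longrightarrow> s u \<in> weak_subdiff r X h u"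
    and p: "p \<in> rel_interior X" and e: "e > 0"
  obtains u where "u \<in> X" "norm (u - p) < e" "(h has_derivative (\<lambda>y. s u \<bullet> y)) (at u within X)"
proof -
  obtain u K d where u: "u \<in> rel_interior X" "norm (u - p) < e" "d > 0"
    "\<And>y. y \<in> X \<Longrightarrow> norm (y - u) < d \<Longrightarrow> h y \<le> h u + K * ((norm (y - p))\<^sup>2 - (norm (u - p))\<^sup>2)"
    using parabola_above_dense[OF cont p e] by metis
  have uX: "u \<in> X" using u(1) rel_interior_subset by blast
  show thesis
    by (rule that[OF uX u(2) has_derivative_of_parabola_above[OF X u(1) s[OF uX] u(3,4)]])
qed

section \<open>First-order conditions in terms of limiting gradients\<close>

text \<open>
  The derivatives are restricted to a fixed selection s of subgradients because a derivative within X is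
  determined only up to vectors orthogonal to all differences of points of X: if X is not
  full-dimensional, the set of all limits of derivatives is unbounded, while a bounded selection gives a
  compact set. The intersection of closures is the set of limits of sequences, written so that it is
  visibly closed.
\<close>
definition limiting_gradients ::
    "'a::real_inner set \<Rightarrow> ('a \<Rightarrow> real) \<Rightarrow> ('a \<Rightarrow> 'a) \<Rightarrow> 'a \<Rightarrow> 'a set" where
  "limiting_gradients X h s x = (\<Inter>n. closure (s ` {u \<in> X. norm (u - x) < 1 / real (Suc n) \<and>
     (h has_derivative (\<lambda>y. s u \<bullet> y)) (at u within X)}))"

lemma limiting_gradientsI:
  assumes u: "\<And>i. u i \<in> X" "\<And>i. (h has_derivative (\<lambda>y. s (u i) \<bullet> y)) (at (u i) within X)"
    and ux: "u \<longlonglongrightarrow> x" and sz: "(\<lambda>i. s (u i)) \<longlonglongrightarrow> \<zeta>"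
  shows "\<zeta> \<in> limiting_gradients X h s x"
  unfolding limiting_gradients_def
proof
  fix n :: nat
  have "\<forall>\<^sub>F i in sequentially. dist (u i) x < 1 / real (Suc n)"
    using ux by (rule tendstoD) simp
  then have ev: "\<forall>\<^sub>F i in sequentially. s (u i) \<in> closure (s ` {u \<in> X. norm (u - x) < 1 / real (Suc n) \<and>
     (h has_derivative (\<lambda>y. s u \<bullet> y)) (at u within X)})"
  proof eventually_elim
    case (elim i)
    show ?case
      using elim u[of i] by (intro subsetD[OF closure_subset] imageI) (simp add: dist_norm)
  qed
  show "\<zeta> \<in> closure (s ` {u \<in> X. norm (u - x) < 1 / real (Suc n) \<and>
     (h has_derivative (\<lambda>y. s u \<bullet> y)) (at u within X)})"
    by (rule Lim_in_closed_set[OF closed_closure ev trivial_limit_sequentially sz])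
qed

lemma limiting_gradients_subset_cball:
  assumes "\<And>u. u \<in> X \<Longrightarrow> norm (s u) \<le> M"
  shows "limiting_gradients X h s x \<subseteq> cball 0 M"
proof -
  have "closure (s ` {u \<in> X. norm (u - x) < 1 / real (Suc 0) \<and>
     (h has_derivative (\<lambda>y. s u \<bullet> y)) (at u within X)}) \<subseteq> cball 0 M"
    using assms by (intro closure_minimal) auto
  then show ?thesis unfolding limiting_gradients_def by blast
qed

lemma compact_limiting_gradients:
  fixes s :: "'a::euclidean_space \<Rightarrow> 'a"
  assumes "\<And>u. u \<in> X \<Longrightarrow> norm (s u) \<le> M"
  shows "compact (limiting_gradients X h s x)"
proof -
  have "closed (limiting_gradients X h s x)"
    unfolding limiting_gradients_def by (intro closed_INT ballI closed_closure)
  moreover have "bounded (limiting_gradients X h s x)"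
    using bounded_subset[OF bounded_cball limiting_gradients_subset_cball] assms by blast
  ultimately show ?thesis by (simp add: compact_eq_bounded_closed)
qed

lemma hull_limiting_gradients_subset_clarke:
  "convex hull (limiting_gradients X h s x) \<subseteq> clarke_subdiff X h x"
  unfolding clarke_subdiff_def
proof (rule hull_mono, rule subsetI, rule CollectI)
  fix \<zeta> assume z: "\<zeta> \<in> limiting_gradients X h s x"
  have "\<exists>u. u \<in> X \<and> norm (u - x) < 1 / real (Suc n) \<and>
      (h has_derivative (\<lambda>y. s u \<bullet> y)) (at u within X) \<and> norm (s u - \<zeta>) < 1 / real (Suc n)" for n
  proof -
    have "\<zeta> \<in> closure (s ` {u \<in> X. norm (u - x) < 1 / real (Suc n) \<and>
       (h has_derivative (\<lambda>y. s u \<bullet> y)) (at u within X)})"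
      using z unfolding limiting_gradients_def by blast
    then obtain w where "w \<in> s ` {u \<in> X. norm (u - x) < 1 / real (Suc n) \<and>
       (h has_derivative (\<lambda>y. s u \<bullet> y)) (at u within X)}" "dist w \<zeta> < 1 / real (Suc n)"
      unfolding closure_approachable by (meson of_nat_0_less_iff zero_less_Suc zero_less_divide_1_iff)
    then show ?thesis by (auto simp: dist_norm)
  qed
  then obtain u where u: "\<And>n. u n \<in> X" "\<And>n. norm (u n - x) < 1 / real (Suc n)"
      "\<And>n. (h has_derivative (\<lambda>y. s (u n) \<bullet> y)) (at (u n) within X)"
      "\<And>n. norm (s (u n) - \<zeta>) < 1 / real (Suc n)"
    by metis
  have "(\<lambda>n. u n - x) \<longlonglongrightarrow> 0"
    by (rule Lim_null_comparison[OF _ LIMSEQ_Suc[OF lim_1_over_n]])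
       (use u(2) in \<open>auto intro!: always_eventually less_imp_le\<close>)
  moreover have "(\<lambda>n. s (u n) - \<zeta>) \<longlonglongrightarrow> 0"
    by (rule Lim_null_comparison[OF _ LIMSEQ_Suc[OF lim_1_over_n]])
       (use u(4) in \<open>auto intro!: always_eventually less_imp_le\<close>)
  ultimately show "\<exists>u s. (\<forall>i::nat. u i \<in> X \<and> (h has_derivative (\<lambda>y. s i \<bullet> y)) (at (u i) within X))
       \<and> u \<longlonglongrightarrow> x \<and> s \<longlonglongrightarrow> \<zeta>"
    using u(1,3) by (intro exI[of _ u] exI[of _ "\<lambda>i. s (u i)"]) (auto simp: LIM_zero_iff)
qed

text \<open>
  A subgradient at a point near x + t (p - x), used in the direction back to x, bounds the increase of h
  from x to that point. The point can be chosen so close that all errors are of order t squared.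
\<close>
lemma gradient_along_direction:
  fixes X :: "'a::euclidean_space set"
  assumes X: "convex X" and cont: "continuous_on X h"
    and s: "\<And>u. u \<in> X \<Longrightarrow> s u \<in> weak_subdiff r X h u" "\<And>u. u \<in> X \<Longrightarrow> norm (s u) \<le> M"
    and x: "x \<in> X" and p: "p \<in> rel_interior X" and t: "0 < t" "t \<le> 1"
  obtains u where "u \<in> X" "(h has_derivative (\<lambda>y. s u \<bullet> y)) (at u within X)"
    "norm (u - x) \<le> t * (norm (p - x) + 1)"
    "t * (s u \<bullet> (p - x)) \<ge> h (x + t *\<^sub>R (p - x)) - h x
       - t\<^sup>2 * (1 + M + \<bar>r\<bar> / 2 * (norm (p - x) + 1)\<^sup>2)"
proof -
  define d where "d = p - x"
  define w where "w = x + t *\<^sub>R d"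
  have w: "w \<in> rel_interior X"
    using rel_interior_convex_shrink[OF X p x t] by (simp add: w_def d_def algebra_simps)
  then have wX: "w \<in> X" using rel_interior_subset by blast
  have t2: "t\<^sup>2 > 0" using t by simp
  obtain e where e: "e > 0" "\<And>u. u \<in> X \<Longrightarrow> dist u w < e \<Longrightarrow> dist (h u) (h w) < t\<^sup>2"
    using cont wX t2 unfolding continuous_on_iff by metis
  have "min e (t\<^sup>2) > 0" using e t2 by simp
  then obtain u where u: "u \<in> X" "norm (u - w) < min e (t\<^sup>2)"
    and der: "(h has_derivative (\<lambda>y. s u \<bullet> y)) (at u within X)"
    using differentiability_dense[OF X cont s(1) w] by metis
  have tt: "t\<^sup>2 \<le> t" using t by (simp add: power2_eq_square mult_left_le)
  have "norm (u - x) \<le> norm (u - w) + norm (w - x)"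
    using norm_triangle_ineq[of "u - w" "w - x"] by simp
  also have "norm (w - x) = t * norm d" using t by (simp add: w_def)
  finally have near: "norm (u - x) \<le> t * (norm d + 1)"
    using u(2) tt by (simp add: algebra_simps)
  have "h x \<ge> h u + s u \<bullet> (x - u) - r / 2 * (norm (x - u))\<^sup>2"
    using s(1)[OF u(1)] x unfolding weak_subdiff_def by blast
  moreover have "r / 2 * (norm (x - u))\<^sup>2 \<le> \<bar>r\<bar> / 2 * (t * (norm d + 1))\<^sup>2"
    using near by (intro mult_mono power_mono) (auto simp: norm_minus_commute)
  moreover have "s u \<bullet> (x - u) = - (s u \<bullet> (u - w)) - t * (s u \<bullet> d)"
    by (simp add: w_def inner_diff_right inner_add_right)
  moreover have "s u \<bullet> (u - w) \<le> M * t\<^sup>2"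
  proof -
    have "s u \<bullet> (u - w) \<le> norm (s u) * norm (u - w)" by (rule norm_cauchy_schwarz)
    also have "\<dots> \<le> M * t\<^sup>2"
      using s(2)[OF u(1)] u(2) order_trans[OF norm_ge_zero s(2)[OF u(1)]]
      by (intro mult_mono) auto
    finally show ?thesis .
  qed
  moreover have "h u \<ge> h w - t\<^sup>2"
    using e(2)[OF u(1)] u(2) by (auto simp: dist_norm)
  moreover have "\<bar>r\<bar> / 2 * (t * (norm d + 1))\<^sup>2 = t\<^sup>2 * (\<bar>r\<bar> / 2 * (norm d + 1)\<^sup>2)"
    by (simp add: power_mult_distrib)
  ultimately have "t * (s u \<bullet> d) \<ge> h w - h x - (t\<^sup>2 + M * t\<^sup>2 + t\<^sup>2 * (\<bar>r\<bar> / 2 * (norm d + 1)\<^sup>2))"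
    by linarith
  then have "t * (s u \<bullet> d) \<ge> h w - h x - t\<^sup>2 * (1 + M + \<bar>r\<bar> / 2 * (norm d + 1)\<^sup>2)"
    by (simp add: distrib_left distrib_right mult.commute)
  then show thesis using that[OF u(1) der] near unfolding w_def d_def by blast
qed

text \<open>
  The same subsequence serves both functions, so the limits a and b belong to the same direction. They
  still depend on that direction; the next lemma removes this dependence.
\<close>
lemma limiting_gradients_along_direction:
  fixes X :: "'a::euclidean_space set"
  assumes X: "convex X" and cont: "continuous_on X f" "continuous_on X g"
    and sf: "\<And>u. u \<in> X \<Longrightarrow> sf u \<in> weak_subdiff r X f u" "\<And>u. u \<in> X \<Longrightarrow> norm (sf u) \<le> M"
    and sg: "\<And>u. u \<in> X \<Longrightarrow> sg u \<in> weak_subdiff r X g u" "\<And>u. u \<in> X \<Longrightarrow> norm (sg u) \<le> M"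
    and x: "x \<in> X" and p: "p \<in> rel_interior X" and l: "0 \<le> l"
    and min: "\<And>y. y \<in> X \<Longrightarrow> f y + l * g y + q \<bullet> (y - x) + k * (norm (y - x))\<^sup>2 \<ge> f x + l * g x"
  shows "\<exists>a \<in> limiting_gradients X f sf x. \<exists>b \<in> limiting_gradients X g sg x.
    (a + l *\<^sub>R b + q) \<bullet> (p - x) \<ge> 0"
proof -
  define d where "d = p - x"
  define C where "C = 1 + M + \<bar>r\<bar> / 2 * (norm d + 1)\<^sup>2"
  define t where "t n = 1 / real (Suc n)" for n
  have t: "0 < t n" "t n \<le> 1" for n by (auto simp: t_def)
  have t0: "t \<longlonglongrightarrow> 0" unfolding t_def by (rule LIMSEQ_Suc[OF lim_1_over_n])
  have "\<exists>u. u \<in> X \<and> (f has_derivative (\<lambda>y. sf u \<bullet> y)) (at u within X) \<and>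
      norm (u - x) \<le> t n * (norm d + 1) \<and>
      t n * (sf u \<bullet> d) \<ge> f (x + t n *\<^sub>R d) - f x - (t n)\<^sup>2 * C" for n
    unfolding d_def C_def
    by (rule gradient_along_direction[OF X cont(1) sf x p t[of n]]) blast+
  then obtain u where u: "\<And>n. u n \<in> X"
      "\<And>n. (f has_derivative (\<lambda>y. sf (u n) \<bullet> y)) (at (u n) within X)"
      "\<And>n. norm (u n - x) \<le> t n * (norm d + 1)"
      "\<And>n. t n * (sf (u n) \<bullet> d) \<ge> f (x + t n *\<^sub>R d) - f x - (t n)\<^sup>2 * C"
    by metis
  have "\<exists>u. u \<in> X \<and> (g has_derivative (\<lambda>y. sg u \<bullet> y)) (at u within X) \<and>
      norm (u - x) \<le> t n * (norm d + 1) \<and>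
      t n * (sg u \<bullet> d) \<ge> g (x + t n *\<^sub>R d) - g x - (t n)\<^sup>2 * C" for n
    unfolding d_def C_def
    by (rule gradient_along_direction[OF X cont(2) sg x p t[of n]]) blast+
  then obtain v where v: "\<And>n. v n \<in> X"
      "\<And>n. (g has_derivative (\<lambda>y. sg (v n) \<bullet> y)) (at (v n) within X)"
      "\<And>n. norm (v n - x) \<le> t n * (norm d + 1)"
      "\<And>n. t n * (sg (v n) \<bullet> d) \<ge> g (x + t n *\<^sub>R d) - g x - (t n)\<^sup>2 * C"
    by metis
  have bnd: "(\<lambda>n. t n * (norm d + 1)) \<longlonglongrightarrow> 0"
    using tendsto_mult_left_zero[OF t0] by simp
  have ux: "u \<longlonglongrightarrow> x"
    using Lim_null_comparison[OF always_eventually bnd, of "\<lambda>n. u n - x"] u(3) by (simp add: LIM_zero_iff)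
  have vx: "v \<longlonglongrightarrow> x"
    using Lim_null_comparison[OF always_eventually bnd, of "\<lambda>n. v n - x"] v(3) by (simp add: LIM_zero_iff)
  have "seq_compact (cball 0 M \<times> cball 0 M :: ('a \<times> 'a) set)"
    by (intro compact_imp_seq_compact compact_Times compact_cball)
  moreover have "\<forall>n. (sf (u n), sg (v n)) \<in> cball 0 M \<times> cball 0 M"
    using sf(2)[OF u(1)] sg(2)[OF v(1)] by simp
  ultimately obtain ab k' where ab: "strict_mono (k'::nat\<Rightarrow>nat)"
      "((\<lambda>n. (sf (u n), sg (v n))) \<circ> k') \<longlonglongrightarrow> ab"
    by (rule seq_compactE)
  define a b where "a = fst ab" and "b = snd ab"
  have a: "(\<lambda>n. sf (u (k' n))) \<longlonglongrightarrow> a" and b: "(\<lambda>n. sg (v (k' n))) \<longlonglongrightarrow> b"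
    using tendsto_fst[OF ab(2)] tendsto_snd[OF ab(2)] unfolding a_def b_def by (simp_all add: o_def)
  have aL: "a \<in> limiting_gradients X f sf x"
  proof (rule limiting_gradientsI[where u = "\<lambda>n. u (k' n)"])
    show "(\<lambda>n. u (k' n)) \<longlonglongrightarrow> x"
      using LIMSEQ_subseq_LIMSEQ[OF ux ab(1)] by (simp only: o_def)
  qed (rule u(1) u(2) a)+
  have bL: "b \<in> limiting_gradients X g sg x"
  proof (rule limiting_gradientsI[where u = "\<lambda>n. v (k' n)"])
    show "(\<lambda>n. v (k' n)) \<longlonglongrightarrow> x"
      using LIMSEQ_subseq_LIMSEQ[OF vx ab(1)] by (simp only: o_def)
  qed (rule v(1) v(2) b)+
  have ineq: "(sf (u n) + l *\<^sub>R sg (v n) + q) \<bullet> d \<ge> - (t n * (C + l * C + k * (norm d)\<^sup>2))" for n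
  proof -
    have "(1 - t n) *\<^sub>R x + t n *\<^sub>R p \<in> X"
      using X x p t[of n] rel_interior_subset by (intro convexD_alt) auto
    then have wX: "x + t n *\<^sub>R d \<in> X" by (simp add: d_def algebra_simps)
    have "f x + l * g x \<le> f (x + t n *\<^sub>R d) + l * g (x + t n *\<^sub>R d) + t n * (q \<bullet> d) + (t n)\<^sup>2 * (k * (norm d)\<^sup>2)"
      using min[OF wX] t(1)[of n] by (simp add: power_mult_distrib algebra_simps)
    moreover have "l * (t n * (sg (v n) \<bullet> d)) \<ge> l * (g (x + t n *\<^sub>R d) - g x - (t n)\<^sup>2 * C)"
      by (rule mult_left_mono[OF v(4) l])
    ultimately have "t n * (sf (u n) \<bullet> d) + l * (t n * (sg (v n) \<bullet> d)) + t n * (q \<bullet> d)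
        \<ge> - ((t n)\<^sup>2 * C + l * ((t n)\<^sup>2 * C) + (t n)\<^sup>2 * (k * (norm d)\<^sup>2))"
      using u(4)[of n] by (simp add: right_diff_distrib)
    then have "0 \<le> t n * ((sf (u n) + l *\<^sub>R sg (v n) + q) \<bullet> d + t n * (C + l * C + k * (norm d)\<^sup>2))"
      by (simp add: inner_add_left power2_eq_square algebra_simps)
    then show ?thesis using t(1)[of n] by (simp add: zero_le_mult_iff)
  qed
  have "(\<lambda>n. (sf (u (k' n)) + l *\<^sub>R sg (v (k' n)) + q) \<bullet> d + t (k' n) * (C + l * C + k * (norm d)\<^sup>2))
      \<longlonglongrightarrow> (a + l *\<^sub>R b + q) \<bullet> d + 0 * (C + l * C + k * (norm d)\<^sup>2)"
    using LIMSEQ_subseq_LIMSEQ[OF t0 ab(1), unfolded o_def] by (intro tendsto_intros a b)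
  then have "(a + l *\<^sub>R b + q) \<bullet> d + 0 * (C + l * C + k * (norm d)\<^sup>2) \<ge> 0"
  proof (rule LIMSEQ_le_const, intro exI allI impI)
    fix n show "0 \<le> (sf (u (k' n)) + l *\<^sub>R sg (v (k' n)) + q) \<bullet> d + t (k' n) * (C + l * C + k * (norm d)\<^sup>2)"
      using ineq[of "k' n"] by linarith
  qed
  then show ?thesis using aL bL unfolding d_def by auto
qed

text \<open>
  If no member of C were minus a normal vector, a hyperplane would strictly separate C from the dual of
  the cone of feasible directions. By the bipolar argument the separating vector is a limit of multiples
  of feasible directions, and for those the hypothesis provides members of C on the wrong side. Directions
  into the relative interior suffice, because they are dense among the feasible ones.
\<close>
lemma minimax_normal_cone:
  fixes X :: "'a::euclidean_space set"
  assumes X: "convex X" and x: "x \<in> X" and C: "convex C" "compact C"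
    and dir: "\<And>p. p \<in> rel_interior X \<Longrightarrow> \<exists>\<zeta>\<in>C. \<zeta> \<bullet> (p - x) \<ge> 0"
  shows "\<exists>\<zeta>\<in>C. - \<zeta> \<in> normal_cone X x"
proof (rule ccontr)
  assume no: "\<not> (\<exists>\<zeta>\<in>C. - \<zeta> \<in> normal_cone X x)"
  define N where "N = {n. \<forall>y\<in>X. n \<bullet> (y - x) \<ge> 0}"
  have Nint: "N = (\<Inter>y\<in>X. {n. (y - x) \<bullet> n \<ge> 0})" by (auto simp: N_def inner_commute)
  have N: "convex N" "closed N"
    unfolding Nint by (auto intro!: convex_INT closed_INT convex_halfspace_ge closed_halfspace_ge)
  have CN: "C \<inter> N = {}" using no by (auto simp: N_def normal_cone_def)
  obtain p0 where p0: "p0 \<in> rel_interior X"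
    using rel_interior_eq_empty[OF X] x by blast
  have Cne: "C \<noteq> {}" using dir[OF p0] by blast
  obtain a b where ab: "\<forall>\<zeta>\<in>C. a \<bullet> \<zeta> < b" "\<forall>n\<in>N. a \<bullet> n > b"
    using separating_hyperplane_compact_closed[OF C Cne N CN] by blast
  have "0 \<in> N" by (simp add: N_def)
  then have b: "b < 0" using ab(2) by fastforce
  \<comment> \<open>\<open>N\<close> is a cone, so \<open>a\<close> is nonnegative on it, i.e. \<open>a\<close> is a tangent direction.\<close>
  have aN: "a \<bullet> n \<ge> 0" if n: "n \<in> N" for n
  proof (rule ccontr)
    assume neg: "\<not> a \<bullet> n \<ge> 0"
    have "b / (a \<bullet> n) \<ge> 0" using neg b by (intro divide_nonpos_nonpos) auto
    then have "(b / (a \<bullet> n)) *\<^sub>R n \<in> N"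
      using n unfolding N_def by (auto simp only: mem_Collect_eq inner_scaleR_left intro!: mult_nonneg_nonneg)
    then show False using ab(2) neg by fastforce
  qed
  \<comment> \<open>The bipolar theorem for the cone of feasible directions.\<close>
  define K where "K = cone hull ((\<lambda>p. p - x) ` rel_interior X)"
  have Ksub: "p - x \<in> K" if "p \<in> rel_interior X" for p
    unfolding K_def using that by (intro hull_inc) auto
  have Kscale: "c *\<^sub>R k \<in> K" if "k \<in> K" "c \<ge> 0" for k c
    using cone_cone_hull that unfolding K_def cone_def by blast
  have "convex ((\<lambda>p. p - x) ` rel_interior X)"
    using convex_translation_subtract[OF convex_rel_interior[OF X], of x] by simp
  then have "convex K" unfolding K_def by (rule convex_cone_hull)
  have "a \<in> closure K"
  proof (rule ccontr)
    assume "a \<notin> closure K"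
    then obtain m \<beta> where m: "m \<bullet> a < \<beta>" "\<forall>k\<in>closure K. m \<bullet> k > \<beta>"
      using separating_hyperplane_closed_point[OF convex_closure[OF \<open>convex K\<close>] closed_closure] by blast
    have K0: "0 \<in> K" using Kscale[OF Ksub[OF p0], of 0] by simp
    have \<beta>: "\<beta> < 0" using m(2) K0 closure_subset[of K] by force
    have mK: "m \<bullet> k \<ge> 0" if k: "k \<in> K" for k
    proof (rule ccontr)
      assume neg: "\<not> m \<bullet> k \<ge> 0"
      have "(\<beta> / (m \<bullet> k)) *\<^sub>R k \<in> closure K"
        using Kscale[OF k divide_nonpos_nonpos] neg \<beta> closure_subset[of K] by (simp add: subset_iff)
      then show False using m(2) neg by fastforce
    qed
    have "rel_interior X \<subseteq> {y. m \<bullet> y \<ge> m \<bullet> x}"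
      using mK[OF Ksub] by (auto simp: inner_diff_right)
    then have "closure (rel_interior X) \<subseteq> {y. m \<bullet> y \<ge> m \<bullet> x}"
      by (intro closure_minimal closed_halfspace_ge)
    then have "m \<in> N"
      using convex_closure_rel_interior[OF X] closure_subset[of X] by (auto simp: N_def inner_diff_right)
    from aN[OF this] m \<beta> show False by (simp add: inner_commute)
  qed
  obtain R where R: "\<And>\<zeta>. \<zeta> \<in> C \<Longrightarrow> norm \<zeta> \<le> R" "R > 0"
    using compact_imp_bounded[OF C(2)] unfolding bounded_pos by blast
  obtain k where k: "k \<in> K" "dist k a < - b / R"
    using \<open>a \<in> closure K\<close> b R(2) unfolding closure_approachable by (metis divide_pos_pos neg_0_less_iff_less)
  obtain c p where kc: "k = c *\<^sub>R (p - x)" "c \<ge> 0" "p \<in> rel_interior X"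
    using k(1) unfolding K_def cone_hull_expl by blast
  obtain \<zeta> where z: "\<zeta> \<in> C" "\<zeta> \<bullet> (p - x) \<ge> 0" using dir[OF kc(3)] by blast
  have "\<zeta> \<bullet> k \<ge> 0" using z(2) kc by simp
  moreover have "\<zeta> \<bullet> (k - a) \<le> R * (- b / R)"
  proof -
    have "\<zeta> \<bullet> (k - a) \<le> norm \<zeta> * norm (k - a)" by (rule norm_cauchy_schwarz)
    also have "\<dots> \<le> R * (- b / R)"
      using R(1)[OF z(1)] R(2) k(2) by (intro mult_mono) (auto simp: dist_norm)
    finally show ?thesis .
  qed
  ultimately have "a \<bullet> \<zeta> \<ge> b" using R(2) by (simp add: inner_diff_right inner_commute)
  then show False using ab(1) z(1) by fastforce
qed

text \<open>
  This takes the place of the subdifferential sum rule together with the representation of convex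
  subgradients on the boundary of X as limits of gradients plus normal vectors. Obtaining Clarke
  subgradients of norm at most M directly keeps f and g separate and makes the multiplier bound explicit.
\<close>
lemma stationarity_of_lagrangian_minimizer:
  fixes X :: "'a::euclidean_space set"
  assumes X: "convex X" and cont: "continuous_on X f" "continuous_on X g"
    and sf: "\<And>u. u \<in> X \<Longrightarrow> sf u \<in> weak_subdiff r X f u" "\<And>u. u \<in> X \<Longrightarrow> norm (sf u) \<le> M"
    and sg: "\<And>u. u \<in> X \<Longrightarrow> sg u \<in> weak_subdiff r X g u" "\<And>u. u \<in> X \<Longrightarrow> norm (sg u) \<le> M"
    and x: "x \<in> X" and l: "0 \<le> l"
    and min: "\<And>y. y \<in> X \<Longrightarrow> f y + l * g y + q \<bullet> (y - x) + k * (norm (y - x))\<^sup>2 \<ge> f x + l * g x"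
  obtains a b where "a \<in> clarke_subdiff X f x" "norm a \<le> M"
    "b \<in> clarke_subdiff X g x" "norm b \<le> M" "- (a + l *\<^sub>R b + q) \<in> normal_cone X x"
proof -
  let ?A = "convex hull (limiting_gradients X f sf x)"
  let ?B = "convex hull (limiting_gradients X g sg x)"
  define C where "C = (\<lambda>(a, b). a + l *\<^sub>R b + q) ` (?A \<times> ?B)"
  have C2: "C = (\<lambda>z. q + z) ` ((\<lambda>(a, b). a + l *\<^sub>R b) ` (?A \<times> ?B))"
    unfolding C_def by (force simp: image_image)
  have "linear (\<lambda>(a, b). a + l *\<^sub>R b :: 'a)"
    by (rule linearI) (auto simp: algebra_simps)
  then have "convex C"
    unfolding C2 by (intro convex_translation convex_linear_image convex_Times convex_convex_hull)
  moreover have "compact C"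
    unfolding C_def case_prod_beta
    by (intro compact_continuous_image continuous_intros compact_Times compact_convex_hull
        compact_limiting_gradients) (use sf sg in auto)
  moreover have "\<exists>\<zeta>\<in>C. \<zeta> \<bullet> (p - x) \<ge> 0" if p: "p \<in> rel_interior X" for p
  proof -
    obtain a b where "a \<in> limiting_gradients X f sf x" "b \<in> limiting_gradients X g sg x"
      "(a + l *\<^sub>R b + q) \<bullet> (p - x) \<ge> 0"
      using limiting_gradients_along_direction[OF X cont sf sg x p l min] by metis
    then show ?thesis unfolding C_def by (force intro: hull_inc)
  qed
  ultimately obtain \<zeta> where "\<zeta> \<in> C" and n: "- \<zeta> \<in> normal_cone X x"
    using minimax_normal_cone[OF X x] by metis
  then obtain a b where ab: "a \<in> ?A" "b \<in> ?B" "\<zeta> = a + l *\<^sub>R b + q" unfolding C_def by auto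
  have "?A \<subseteq> cball 0 M" "?B \<subseteq> cball 0 M"
    using limiting_gradients_subset_cball[of X sf M f x, OF sf(2)]
      limiting_gradients_subset_cball[of X sg M g x, OF sg(2)]
    by (metis hull_minimal convex_cball)+
  then show thesis
    using that[of a b] ab n hull_limiting_gradients_subset_clarke by (metis mem_cball_0 subsetD)
qed

section \<open>Convergence of the switching subgradient method\<close>

lemma ssm_iter_in:
  assumes "closed Z" "z0 \<in> Z"
  shows "ssm_iter Z dF G dG \<tau> \<alpha> z0 t \<in> Z"
  using assms closest_point_in_set[of Z] by (cases t) (auto simp: Let_def)

text \<open>
  The projection does not increase the distance to a point of Z, and strong convexity turns the inner
  product of the subgradient with the error into a function value gap plus a multiple of the squared
  error.
\<close>
lemma projected_step_sq_dist:
  fixes Z :: "'a::euclidean_space set"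
  assumes Z: "closed Z" "convex Z" and xh: "xh \<in> Z" and a: "0 \<le> a"
    and \<zeta>: "\<zeta> \<in> weak_subdiff (- \<mu>) Z H z"
  shows "(norm (closest_point Z (z - a *\<^sub>R \<zeta>) - xh))\<^sup>2
    \<le> (1 - a * \<mu>) * (norm (z - xh))\<^sup>2 - 2 * a * (H z - H xh) + a\<^sup>2 * (norm \<zeta>)\<^sup>2"
proof -
  have "dist (closest_point Z (z - a *\<^sub>R \<zeta>)) (closest_point Z xh) \<le> dist (z - a *\<^sub>R \<zeta>) xh"
    using Z xh by (intro closest_point_lipschitz) auto
  then have "norm (closest_point Z (z - a *\<^sub>R \<zeta>) - xh) \<le> norm ((z - xh) - a *\<^sub>R \<zeta>)"
    using closest_point_self[OF xh] by (simp add: dist_norm algebra_simps)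
  then have "(norm (closest_point Z (z - a *\<^sub>R \<zeta>) - xh))\<^sup>2 \<le> (norm ((z - xh) - a *\<^sub>R \<zeta>))\<^sup>2"
    by (intro power_mono) auto
  also have "\<dots> = (norm (z - xh))\<^sup>2 + a\<^sup>2 * (norm \<zeta>)\<^sup>2 - 2 * a * (\<zeta> \<bullet> (z - xh))"
    unfolding norm_diff_sq[of "z - xh"] by (simp add: power_mult_distrib inner_commute)
  finally have 1: "(norm (closest_point Z (z - a *\<^sub>R \<zeta>) - xh))\<^sup>2
      \<le> (norm (z - xh))\<^sup>2 + a\<^sup>2 * (norm \<zeta>)\<^sup>2 - 2 * a * (\<zeta> \<bullet> (z - xh))" .
  have "H xh \<ge> H z + \<zeta> \<bullet> (xh - z) - (- \<mu>) / 2 * (norm (xh - z))\<^sup>2"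
    using \<zeta> xh unfolding weak_subdiff_def by blast
  then have "\<zeta> \<bullet> (z - xh) \<ge> H z - H xh + \<mu> / 2 * (norm (z - xh))\<^sup>2"
    by (simp add: inner_diff_right norm_minus_commute)
  then have "2 * a * (\<zeta> \<bullet> (z - xh)) \<ge> 2 * a * (H z - H xh + \<mu> / 2 * (norm (z - xh))\<^sup>2)"
    using a by (intro mult_left_mono) auto
  then show ?thesis using 1 by (simp add: algebra_simps)
qed

text \<open>
  The squared subgradients may grow like L times the constraint value. In a step on the objective the
  constraint value is at most \<open>\<tau>\<close>, so the growth is at most \<open>L \<tau>\<close>,
  whatever the sign of the objective gap. In a step on the constraint it is at most L times the very
  quantity by which the step makes progress. As \<open>\<alpha> t * L \<le> 1\<close>, the growth costs at
  most \<open>\<alpha> t * \<tau>\<close> in the first case and half of the progress in the second. With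
  the weights \<open>t + 1\<close> the squared distances telescope. Each step on the constraint
  contributes more than its share of the right-hand side of the budget, so the steps on the objective must
  contribute less than theirs, on average; in particular there is at least one of them.
\<close>
theorem ssm_weighted_gap:
  fixes Z :: "'a::euclidean_space set"
  assumes Z: "closed Z" "convex Z" and xh: "xh \<in> Z" "G xh \<le> 0" and z0: "z0 \<in> Z"
    and pos: "\<mu> > 0" "L \<ge> 0" "A \<ge> 0" "\<tau> > 0"
    and \<alpha>: "\<And>t. \<alpha> t = 2 / (\<mu> * (real t + 2) + L\<^sup>2 / (\<mu> * (real t + 1)))"
    and dF: "\<And>t z. z \<in> Z \<Longrightarrow> dF t z \<in> weak_subdiff (- \<mu>) Z F z"
    and dG: "\<And>t z. z \<in> Z \<Longrightarrow> dG t z \<in> weak_subdiff (- \<mu>) Z G z"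
    and nF: "\<And>t z. z \<in> Z \<Longrightarrow> G z \<le> \<tau> \<Longrightarrow> (norm (dF t z))\<^sup>2 \<le> A + L * \<tau>"
    and nG: "\<And>t z. z \<in> Z \<Longrightarrow> G z > \<tau> \<Longrightarrow> (norm (dG t z))\<^sup>2 \<le> A + L * G z"
    and budget: "L\<^sup>2 / (2 * \<mu>) * (norm (z0 - xh))\<^sup>2 + 2 * A / \<mu> * real T < \<tau> * (real T * (real T + 1) / 2)"
  shows "(\<Sum>t \<in> ssm_I Z dF G dG \<tau> T \<alpha> z0. real (t + 1) * (F (ssm_iter Z dF G dG \<tau> \<alpha> z0 t) - F xh - \<tau>)) < 0"
proof -
  define z where "z = ssm_iter Z dF G dG \<tau> \<alpha> z0"
  define w where "w t = (norm (z t - xh))\<^sup>2" for t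
  define e where "e t = (if G (z t) \<le> \<tau> then 2 * (F (z t) - F xh) - \<tau> else G (z t))" for t
  \<comment> \<open>These are the coefficients of the telescoping sum: \<open>V t = (t + 1) * (1 / \<alpha> t - \<mu>)\<close> and
    \<open>V (Suc t) = (t + 1) / \<alpha> t\<close>.\<close>
  define V where "V t = \<mu> * real t * (real t + 1) / 2 + L\<^sup>2 / (2 * \<mu>)" for t
  have zZ: "z t \<in> Z" for t unfolding z_def by (rule ssm_iter_in[OF Z(1) z0])
  have \<alpha>pos: "\<alpha> t > 0" for t
  proof -
    have "\<mu> * (real t + 2) > 0" "L\<^sup>2 / (\<mu> * (real t + 1)) \<ge> 0" using pos by auto
    then show ?thesis unfolding \<alpha> by simp
  qed
  have inv\<alpha>: "1 / \<alpha> t = (\<mu> * (real t + 2) + L\<^sup>2 / (\<mu> * (real t + 1))) / 2" for t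
    unfolding \<alpha> by simp
  have \<alpha>L: "\<alpha> t * L \<le> 1" for t
  proof -
    define k where "k = \<mu> * (real t + 1)"
    have k: "k > 0" using pos unfolding k_def by simp
    have "0 \<le> (k - L)\<^sup>2 / k" using k by simp
    also have "\<dots> = k + L\<^sup>2 / k - 2 * L" using k by (simp add: power2_diff field_simps power2_eq_square)
    finally have "L \<le> (\<mu> * (real t + 2) + L\<^sup>2 / (\<mu> * (real t + 1))) / 2"
      using pos unfolding k_def by (simp add: distrib_left)
    then have "L \<le> 1 / \<alpha> t" unfolding inv\<alpha> .
    then show ?thesis using \<alpha>pos[of t] by (simp add: field_simps)
  qed
  have \<alpha>t: "(real t + 1) * \<alpha> t \<le> 2 / \<mu>" for t
  proof -
    have "\<mu> * (real t + 1) / 2 \<le> 1 / \<alpha> t"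
      unfolding inv\<alpha> using pos by (simp add: field_simps)
    then show ?thesis using \<alpha>pos[of t] pos by (simp add: field_simps)
  qed
  \<comment> \<open>One step, in a form that no longer shows which of the two subgradients was used.\<close>
  have step: "\<alpha> t * e t \<le> (1 - \<alpha> t * \<mu>) * w t - w (Suc t) + (\<alpha> t)\<^sup>2 * A" for t
  proof (cases "G (z t) \<le> \<tau>")
    case True
    have "w (Suc t) \<le> (1 - \<alpha> t * \<mu>) * w t - 2 * \<alpha> t * (F (z t) - F xh) + (\<alpha> t)\<^sup>2 * (norm (dF t (z t)))\<^sup>2"
      using projected_step_sq_dist[OF Z xh(1) less_imp_le[OF \<alpha>pos] dF[OF zZ], of t] True
      unfolding w_def z_def by (simp add: Let_def)
    also have "(\<alpha> t)\<^sup>2 * (norm (dF t (z t)))\<^sup>2 \<le> (\<alpha> t)\<^sup>2 * (A + L * \<tau>)"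
      using nF[OF zZ True] by (intro mult_left_mono) auto
    also have "(\<alpha> t)\<^sup>2 * (A + L * \<tau>) = (\<alpha> t)\<^sup>2 * A + \<alpha> t * \<tau> * (\<alpha> t * L)"
      by (simp add: power2_eq_square algebra_simps)
    also have "\<alpha> t * \<tau> * (\<alpha> t * L) \<le> \<alpha> t * \<tau> * 1"
      using \<alpha>L \<alpha>pos[of t] pos by (intro mult_left_mono) auto
    finally show ?thesis using True by (simp add: e_def algebra_simps)
  next
    case False
    have "w (Suc t) \<le> (1 - \<alpha> t * \<mu>) * w t - 2 * \<alpha> t * (G (z t) - G xh) + (\<alpha> t)\<^sup>2 * (norm (dG t (z t)))\<^sup>2"
      using projected_step_sq_dist[OF Z xh(1) less_imp_le[OF \<alpha>pos] dG[OF zZ], of t] False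
      unfolding w_def z_def by (simp add: Let_def)
    also have "(\<alpha> t)\<^sup>2 * (norm (dG t (z t)))\<^sup>2 \<le> (\<alpha> t)\<^sup>2 * (A + L * G (z t))"
      using nG[OF zZ] False by (intro mult_left_mono) auto
    also have "(\<alpha> t)\<^sup>2 * (A + L * G (z t)) = (\<alpha> t)\<^sup>2 * A + \<alpha> t * G (z t) * (\<alpha> t * L)"
      by (simp add: power2_eq_square algebra_simps)
    also have "\<alpha> t * G (z t) * (\<alpha> t * L) \<le> \<alpha> t * G (z t) * 1"
      using \<alpha>L \<alpha>pos[of t] pos False by (intro mult_left_mono) auto
    finally have "w (Suc t) \<le> (1 - \<alpha> t * \<mu>) * w t - 2 * \<alpha> t * (G (z t) - G xh) + ((\<alpha> t)\<^sup>2 * A + \<alpha> t * G (z t))"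
      by simp
    moreover have "\<alpha> t * G xh \<le> 0" using \<alpha>pos[of t] xh(2) by (simp add: mult_nonneg_nonpos)
    ultimately show ?thesis using False by (simp add: e_def algebra_simps)
  qed
  have weighted: "(real t + 1) * e t \<le> V t * w t - V (Suc t) * w (Suc t) + 2 * A / \<mu>" for t
  proof -
    have V: "(real t + 1) * (1 / \<alpha> t - \<mu>) = V t" "(real t + 1) * (1 / \<alpha> t) = V (Suc t)"
      using pos unfolding inv\<alpha> V_def by (simp_all add: divide_simps) (simp_all add: algebra_simps)
    have "(real t + 1) / \<alpha> t * (\<alpha> t * e t)
        \<le> (real t + 1) / \<alpha> t * ((1 - \<alpha> t * \<mu>) * w t - w (Suc t) + (\<alpha> t)\<^sup>2 * A)"
      using step \<alpha>pos[of t] by (intro mult_left_mono) auto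
    also have "\<dots> = (real t + 1) * (1 / \<alpha> t - \<mu>) * w t - (real t + 1) * (1 / \<alpha> t) * w (Suc t) + (real t + 1) * \<alpha> t * A"
      using \<alpha>pos[of t] by (simp add: field_simps power2_eq_square)
    also have "\<dots> = V t * w t - V (Suc t) * w (Suc t) + (real t + 1) * \<alpha> t * A"
      unfolding V ..
    also have "(real t + 1) * \<alpha> t * A \<le> 2 / \<mu> * A"
      using \<alpha>t pos by (intro mult_right_mono) auto
    finally show ?thesis using \<alpha>pos[of t] by simp
  qed
  have "(\<Sum>t<T. (real t + 1) * e t) \<le> (\<Sum>t<T. V t * w t - V (Suc t) * w (Suc t) + 2 * A / \<mu>)"
    by (intro sum_mono weighted)
  also have "\<dots> = V 0 * w 0 - V T * w T + 2 * A / \<mu> * T"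
    using sum_lessThan_telescope'[of "\<lambda>t. V t * w t" T] by (simp add: sum.distrib)
  also have "\<dots> \<le> V 0 * w 0 + 2 * A / \<mu> * T"
    using pos unfolding V_def w_def by simp
  also have "\<dots> < \<tau> * (T * (T + 1) / 2)"
    using budget unfolding V_def w_def z_def by (simp add: algebra_simps)
  also have "\<dots> = (\<Sum>t<T. (real t + 1) * \<tau>)"
    by (induction T) (auto simp: algebra_simps)
  finally have "(\<Sum>t<T. (real t + 1) * (e t - \<tau>)) < 0"
    by (simp add: right_diff_distrib sum_subtractf)
  moreover have "(\<Sum>t<T. (real t + 1) * (e t - \<tau>))
      \<ge> (\<Sum>t<T. if G (z t) \<le> \<tau> then 2 * ((real t + 1) * (F (z t) - F xh - \<tau>)) else 0)"
  proof (rule sum_mono)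
    fix t
    show "(if G (z t) \<le> \<tau> then 2 * ((real t + 1) * (F (z t) - F xh - \<tau>)) else 0) \<le> (real t + 1) * (e t - \<tau>)"
    proof (cases "G (z t) \<le> \<tau>")
      case True
      then show ?thesis by (simp add: e_def algebra_simps)
    next
      case False
      then show ?thesis by (simp add: e_def)
    qed
  qed
  moreover have "(\<Sum>t<T. if G (z t) \<le> \<tau> then 2 * ((real t + 1) * (F (z t) - F xh - \<tau>)) else 0)
      = 2 * (\<Sum>t\<in>{t. t < T \<and> G (z t) \<le> \<tau>}. (real t + 1) * (F (z t) - F xh - \<tau>))"
    unfolding sum_distrib_left
    by (subst sum.inter_filter[symmetric]) (auto intro!: sum.cong)
  ultimately show ?thesis
    unfolding ssm_I_def z_def by (simp add: add.commute)
qed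

lemma ssm_out_jensen:
  assumes Z: "closed Z" "z0 \<in> Z" and H: "convex_on Z H" and ne: "ssm_I Z dF G dG \<tau> T \<alpha> z0 \<noteq> {}"
  shows "ssm_out Z dF G dG \<tau> T \<alpha> z0 \<in> Z"
    and "(\<Sum>t \<in> ssm_I Z dF G dG \<tau> T \<alpha> z0. real (t + 1)) * H (ssm_out Z dF G dG \<tau> T \<alpha> z0)
      \<le> (\<Sum>t \<in> ssm_I Z dF G dG \<tau> T \<alpha> z0. real (t + 1) * H (ssm_iter Z dF G dG \<tau> \<alpha> z0 t))"
proof -
  define I where "I = ssm_I Z dF G dG \<tau> T \<alpha> z0"
  define z where "z = ssm_iter Z dF G dG \<tau> \<alpha> z0"
  define S where "S = (\<Sum>t\<in>I. real (t + 1))"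
  have fin: "finite I" unfolding I_def ssm_I_def by simp
  have ne': "I \<noteq> {}" using ne unfolding I_def .
  have S: "S > 0" unfolding S_def using fin ne' by (intro sum_pos) auto
  have zZ: "z t \<in> Z" for t unfolding z_def by (rule ssm_iter_in[OF Z])
  have sum1: "(\<Sum>t\<in>I. real (t + 1) / S) = 1"
    unfolding sum_divide_distrib[symmetric] S_def[symmetric] using S by simp
  have out: "ssm_out Z dF G dG \<tau> T \<alpha> z0 = (\<Sum>t\<in>I. (real (t + 1) / S) *\<^sub>R z t)"
    unfolding ssm_out_def I_def[symmetric] z_def[symmetric] S_def[symmetric] scaleR_sum_right
    by (simp add: divide_inverse mult.commute)
  have conv: "convex Z" using H unfolding convex_on_def by blast
  show "ssm_out Z dF G dG \<tau> T \<alpha> z0 \<in> Z"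
    unfolding out using fin conv sum1 S zZ by (intro convex_sum) auto
  have "H (ssm_out Z dF G dG \<tau> T \<alpha> z0) \<le> (\<Sum>t\<in>I. (real (t + 1) / S) * H (z t))"
    unfolding out using fin ne' H sum1 S zZ by (intro convex_on_sum) auto
  also have "\<dots> = (\<Sum>t\<in>I. real (t + 1) * H (z t)) / S"
    unfolding sum_divide_distrib by simp
  finally show "(\<Sum>t \<in> ssm_I Z dF G dG \<tau> T \<alpha> z0. real (t + 1)) * H (ssm_out Z dF G dG \<tau> T \<alpha> z0)
      \<le> (\<Sum>t \<in> ssm_I Z dF G dG \<tau> T \<alpha> z0. real (t + 1) * H (ssm_iter Z dF G dG \<tau> \<alpha> z0 t))"
    unfolding I_def[symmetric] z_def[symmetric] S_def[symmetric] using S by (simp add: field_simps)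
qed

theorem ssm_convergence:
  fixes Z :: "'a::euclidean_space set"
  assumes Z: "closed Z" and F: "convex_on Z F" and G: "convex_on Z G"
    and xh: "xh \<in> Z" "G xh \<le> 0" and z0: "z0 \<in> Z"
    and pos: "\<mu> > 0" "L \<ge> 0" "A \<ge> 0" "\<tau> > 0"
    and \<alpha>: "\<And>t. \<alpha> t = 2 / (\<mu> * (real t + 2) + L\<^sup>2 / (\<mu> * (real t + 1)))"
    and dF: "\<And>t z. z \<in> Z \<Longrightarrow> dF t z \<in> weak_subdiff (- \<mu>) Z F z"
    and dG: "\<And>t z. z \<in> Z \<Longrightarrow> dG t z \<in> weak_subdiff (- \<mu>) Z G z"
    and nF: "\<And>t z. z \<in> Z \<Longrightarrow> G z \<le> \<tau> \<Longrightarrow> (norm (dF t z))\<^sup>2 \<le> A + L * \<tau>"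
    and nG: "\<And>t z. z \<in> Z \<Longrightarrow> G z > \<tau> \<Longrightarrow> (norm (dG t z))\<^sup>2 \<le> A + L * G z"
    and budget: "L\<^sup>2 / (2 * \<mu>) * (norm (z0 - xh))\<^sup>2 + 2 * A / \<mu> * real T < \<tau> * (real T * (real T + 1) / 2)"
  defines "out \<equiv> ssm_out Z dF G dG \<tau> T \<alpha> z0"
  shows "out \<in> Z" "F out < F xh + \<tau>" "G out \<le> \<tau>"
proof -
  define I where "I = ssm_I Z dF G dG \<tau> T \<alpha> z0"
  define z where "z = ssm_iter Z dF G dG \<tau> \<alpha> z0"
  define S where "S = (\<Sum>t\<in>I. real (t + 1))"
  have cZ: "convex Z" using F unfolding convex_on_def by blast
  have gap: "(\<Sum>t\<in>I. real (t + 1) * (F (z t) - F xh - \<tau>)) < 0"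
    unfolding I_def z_def
    by (rule ssm_weighted_gap[OF Z cZ xh z0 pos \<alpha> dF dG nF nG budget])
  have ne: "I \<noteq> {}" using gap by auto
  have S: "S > 0" unfolding S_def using ne by (intro sum_pos) (auto simp: I_def ssm_I_def)
  note jensen = ssm_out_jensen[OF Z z0 _ ne[unfolded I_def], folded out_def I_def z_def S_def]
  show "out \<in> Z" by (rule jensen(1)[OF F])
  have "S * F out \<le> (\<Sum>t\<in>I. real (t + 1) * F (z t))" by (rule jensen(2)[OF F])
  also have "\<dots> = (\<Sum>t\<in>I. real (t + 1) * (F (z t) - F xh - \<tau>)) + S * (F xh + \<tau>)"
    unfolding S_def sum_distrib_right sum.distrib[symmetric] by (simp add: algebra_simps)
  also have "\<dots> < S * (F xh + \<tau>)" using gap by simp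
  finally show "F out < F xh + \<tau>" using S by simp
  have "S * G out \<le> (\<Sum>t\<in>I. real (t + 1) * G (z t))" by (rule jensen(2)[OF G])
  also have "\<dots> \<le> (\<Sum>t\<in>I. real (t + 1) * \<tau>)"
    by (intro sum_mono mult_left_mono) (auto simp: I_def ssm_I_def z_def)
  also have "\<dots> = S * \<tau>" unfolding S_def sum_distrib_right ..
  finally show "G out \<le> \<tau>" using S by simp
qed

section \<open>The proximal subproblem\<close>

text \<open>
  The pairs of levels below which F minus its optimal value and G can be brought simultaneously form a
  convex subset of the plane, which misses the origin because xh is optimal. The Slater point prevents the
  separating functional from ignoring F.
\<close>
lemma lagrange_multiplier:
  assumes F: "convex_on X F" and G: "convex_on X G"
    and xh: "xh \<in> X" "G xh \<le> 0" and opt: "\<And>y. y \<in> X \<Longrightarrow> G y \<le> 0 \<Longrightarrow> F xh \<le> F y"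
    and slater: "y0 \<in> X" "G y0 < 0"
  obtains l :: real where "l \<ge> 0" "l * G xh = 0" "\<And>y. y \<in> X \<Longrightarrow> F xh \<le> F y + l * G y"
proof -
  define S where "S = {(a, b). \<exists>y\<in>X. F y - F xh < a \<and> G y < b}"
  have "convex S"
  proof (rule convexI)
    fix p q :: "real \<times> real" and u v :: real
    assume p: "p \<in> S" and q: "q \<in> S" and uv: "0 \<le> u" "0 \<le> v" "u + v = 1"
    obtain y z where y: "y \<in> X" "F y - F xh < fst p" "G y < snd p"
      and z: "z \<in> X" "F z - F xh < fst q" "G z < snd q"
      using p q unfolding S_def by (auto simp: case_prod_beta)
    have strict: "u * a + v * b < u * a' + v * b'" if "a < a'" "b < b'" for a b a' b' :: real
    proof (cases "u = 0")
      case True then show ?thesis using uv that by simp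
    next
      case False
      then have "u * a < u * a'" using uv that by simp
      moreover have "v * b \<le> v * b'" using uv that by (intro mult_left_mono) auto
      ultimately show ?thesis by linarith
    qed
    have "u *\<^sub>R y + v *\<^sub>R z \<in> X"
      using F y(1) z(1) uv unfolding convex_on_def convex_def by blast
    moreover have "F (u *\<^sub>R y + v *\<^sub>R z) - F xh < u * fst p + v * fst q"
    proof -
      have "F (u *\<^sub>R y + v *\<^sub>R z) \<le> u * F y + v * F z"
        using F y(1) z(1) uv unfolding convex_on_def by blast
      moreover have "F xh = u * F xh + v * F xh"
        using uv by (simp add: distrib_right[symmetric])
      ultimately show ?thesis using strict[OF y(2) z(2)] by (simp add: right_diff_distrib)
    qed
    moreover have "G (u *\<^sub>R y + v *\<^sub>R z) < u * snd p + v * snd q"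
    proof -
      have "G (u *\<^sub>R y + v *\<^sub>R z) \<le> u * G y + v * G z"
        using G y(1) z(1) uv unfolding convex_on_def by blast
      then show ?thesis using strict[OF y(3) z(3)] by simp
    qed
    ultimately show "u *\<^sub>R p + v *\<^sub>R q \<in> S"
      unfolding S_def by (auto simp: case_prod_beta)
  qed
  moreover have "0 \<notin> S"
    unfolding S_def using opt by (auto simp: zero_prod_def) (meson less_imp_le not_le)
  ultimately obtain c where c: "c \<noteq> 0" "\<forall>p\<in>S. 0 \<le> c \<bullet> p"
    using separating_hyperplane_set_0 by blast
  define m l where "m = fst c" and "l = snd c"
  have sep: "0 \<le> m * a + l * b" if "y \<in> X" "F y - F xh < a" "G y < b" for y a b
    using c(2) that unfolding S_def m_def l_def by (auto simp: inner_prod_def)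
  have m: "m \<ge> 0"
  proof (rule ccontr)
    assume "\<not> m \<ge> 0"
    define a where "a = max (F y0 - F xh + 1) ((\<bar>l\<bar> + 1) / (- m))"
    have "a \<ge> (\<bar>l\<bar> + 1) / (- m)" unfolding a_def by simp
    then have "m * a \<le> - (\<bar>l\<bar> + 1)" using \<open>\<not> m \<ge> 0\<close> by (simp add: field_simps)
    moreover have "0 \<le> m * a + l * 1" by (rule sep[OF slater(1)]) (use slater(2) in \<open>auto simp: a_def\<close>)
    ultimately show False by linarith
  qed
  have l: "l \<ge> 0"
  proof (rule ccontr)
    assume "\<not> l \<ge> 0"
    define a where "a = F y0 - F xh + 1"
    define b where "b = (\<bar>m * a\<bar> + 1) / (- l)"
    have "b > 0" unfolding b_def using \<open>\<not> l \<ge> 0\<close> by (intro divide_pos_pos) auto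
    then have "0 \<le> m * a + l * b" using sep[OF slater(1), of a b] slater(2) by (simp add: a_def)
    moreover have "l * b = - (\<bar>m * a\<bar> + 1)" unfolding b_def using \<open>\<not> l \<ge> 0\<close> by simp
    ultimately show False by linarith
  qed
  have sep': "0 \<le> m * (F y - F xh) + l * G y" if y: "y \<in> X" for y
  proof (rule field_le_epsilon)
    fix e :: real assume e: "e > 0"
    \<comment> \<open>The added 1 keeps the denominator positive if m and l both vanish.\<close>
    define d where "d = e / (m + l + 1)"
    have d: "d > 0" using e m l unfolding d_def by simp
    have "(m + l) * d \<le> e"
      using e m l unfolding d_def by (simp add: field_simps)
    then show "0 \<le> m * (F y - F xh) + l * G y + e"
      using sep[OF y, of "F y - F xh + d" "G y + d"] d by (simp add: algebra_simps)
  qed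
  have "m > 0"
  proof (rule ccontr)
    assume "\<not> m > 0"
    then have "m = 0" using m by simp
    then have "l > 0" using c(1) l unfolding m_def l_def by (auto simp: prod_eq_iff)
    then show False using sep'[OF slater(1)] slater(2) \<open>m = 0\<close> by (simp add: zero_le_mult_iff)
  qed
  have key: "F xh \<le> F y + (l / m) * G y" if "y \<in> X" for y
    using sep'[OF that] \<open>m > 0\<close> by (simp add: field_simps)
  show thesis
  proof (rule that[of "l / m"])
    show "l / m \<ge> 0" using l m by simp
    then have "(l / m) * G xh \<le> 0" using xh(2) by (intro mult_nonneg_nonpos)
    then show "l / m * G xh = 0" using key[OF xh(1)] by linarith
  qed (rule key)
qed

lemma constrained_prox_minimizer_exists:
  fixes X :: "'a::euclidean_space set" and G :: "'a \<Rightarrow> real"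
  assumes X: "closed X" and F: "continuous_on X f" and G: "continuous_on X G"
    and lb: "\<And>y. y \<in> X \<Longrightarrow> b \<le> f y" and s: "s > 0" and c: "c \<in> X" "G c \<le> 0"
  obtains xh where "xh \<in> X" "G xh \<le> 0"
    "\<And>y. y \<in> X \<Longrightarrow> G y \<le> 0 \<Longrightarrow> prox_fun s f c xh \<le> prox_fun s f c y"
proof -
  define R where "R = sqrt (2 * (f c - b) / s)"
  define S where "S = (X \<inter> G -` {..0}) \<inter> cball c R"
  have R: "R \<ge> 0" "s / 2 * R\<^sup>2 = f c - b" using lb[OF c(1)] s unfolding R_def by auto
  have "compact S"
    unfolding S_def using continuous_closed_preimage[OF G X closed_atMost] by (intro closed_Int_compact) auto
  moreover have cS: "c \<in> S" unfolding S_def using c R by auto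
  moreover have "continuous_on S (prox_fun s f c)"
    unfolding prox_fun_def S_def
    by (intro continuous_intros continuous_on_subset[OF F]) auto
  ultimately obtain xh where xh: "xh \<in> S" "\<And>y. y \<in> S \<Longrightarrow> prox_fun s f c xh \<le> prox_fun s f c y"
    using continuous_attains_inf[of S "prox_fun s f c"] by blast
  show thesis
  proof (rule that[of xh])
    fix y assume y: "y \<in> X" "G y \<le> 0"
    show "prox_fun s f c xh \<le> prox_fun s f c y"
    proof (cases "y \<in> S")
      case False
      then have "R < norm (y - c)" using y unfolding S_def by (auto simp: dist_norm norm_minus_commute)
      then have "R\<^sup>2 \<le> (norm (y - c))\<^sup>2" using R by (intro power_mono) auto
      then have "s / 2 * R\<^sup>2 \<le> s / 2 * (norm (y - c))\<^sup>2" using s by (intro mult_left_mono) auto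
      then have "f c \<le> prox_fun s f c y" using R lb[OF y(1)] unfolding prox_fun_def by simp
      then show ?thesis using xh(2)[OF cS] by (simp add: prox_fun_def)
    qed (rule xh(2))
  qed (use xh(1) in \<open>auto simp: S_def\<close>)
qed

text \<open>
  The subproblem with proximal centre c. The parameters r and s are the weak convexity modulus of f and g
  and the larger proximal weight; fb and gb are lower bounds of f and g on X.
\<close>
locale proximal_subproblem =
  fixes X :: "'a::euclidean_space set" and f g :: "'a \<Rightarrow> real"
    and sf sg :: "nat \<Rightarrow> 'a \<Rightarrow> 'a" and r s M \<sigma> fb gb :: real and c :: 'a
  assumes X: "closed X" "convex X"
    and cont: "continuous_on X f" "continuous_on X g"
    and wc: "weakly_convex_on r X f" "weakly_convex_on r X g"
    and lb: "\<And>y. y \<in> X \<Longrightarrow> fb \<le> f y" "\<And>y. y \<in> X \<Longrightarrow> gb \<le> g y"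
    and sf: "\<And>t z. z \<in> X \<Longrightarrow> sf t z \<in> subdiff X f z \<and> norm (sf t z) \<le> M"
    and sg: "\<And>t z. z \<in> X \<Longrightarrow> sg t z \<in> subdiff X g z \<and> norm (sg t z) \<le> M"
    and c: "c \<in> X" "g c \<le> 0"
    and s: "r < s" "1 < s" and \<sigma>: "\<sigma> > 0"
    and mfcq: "strong_mfcq \<sigma> X (prox_fun s g c)"
begin

abbreviation F where "F \<equiv> prox_fun s f c"
abbreviation G where "G \<equiv> prox_fun s g c"

definition \<mu> where "\<mu> = s - r"
definition D where "D = sqrt ((- 8 * gb) / \<mu>)"
definition B where "B = (M + s * D) / \<sigma>"

lemma \<mu>_pos: "\<mu> > 0" using s by (simp add: \<mu>_def)
lemma gb_nonpos: "gb \<le> 0" using lb(2)[OF c(1)] c(2) by linarith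
lemma D_sq: "D\<^sup>2 = (- 8 * gb) / \<mu>" 
  unfolding D_def using gb_nonpos \<mu>_pos by (intro real_sqrt_pow2 divide_nonneg_pos) auto
lemma D_nonneg: "D \<ge> 0" 
  unfolding D_def using gb_nonpos \<mu>_pos by (intro real_sqrt_ge_zero divide_nonneg_pos) auto
lemma M_nonneg: "M \<ge> 0" using sf[OF c(1), of 0] norm_ge_zero order_trans by blast
lemma B_nonneg: "B \<ge> 0" unfolding B_def using M_nonneg D_nonneg s \<sigma> by simp

lemma weak_subgradients:
  "z \<in> X \<Longrightarrow> sf t z \<in> weak_subdiff r X f z" "z \<in> X \<Longrightarrow> sg t z \<in> weak_subdiff r X g z"
  using sf sg subdiff_subset_weak_subdiff wc cont by blast+

lemma weakly_convex_FG: "weakly_convex_on (- \<mu>) X F" "weakly_convex_on (- \<mu>) X G"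
  using weakly_convex_on_prox_fun[OF wc(1), of s c] weakly_convex_on_prox_fun[OF wc(2), of s c]
  by (simp_all add: \<mu>_def)

lemma convex_FG: "convex_on X F" "convex_on X G"
  by (rule weakly_convex_on_nonpos_imp_convex_on, rule weakly_convex_FG, use \<mu>_pos in simp)+

lemma prox_subgradient:
  assumes "a \<in> clarke_subdiff X g z" "z \<in> X"
  shows "a + s *\<^sub>R (z - c) \<in> subdiff X G z"
proof -
  have "a \<in> weak_subdiff r X g z"
    using clarke_subdiff_subset_weak_subdiff[OF wc(2) cont(2) assms(2)] assms(1) by blast
  then have "a + s *\<^sub>R (z - c) \<in> weak_subdiff (- \<mu>) X G z"
    using weak_subdiff_prox_fun[of a r X g z s c] by (simp add: \<mu>_def)
  moreover have "weak_subdiff (- \<mu>) X G z \<subseteq> convex_subdiff X G z"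
  proof
    fix \<zeta> assume z: "\<zeta> \<in> weak_subdiff (- \<mu>) X G z"
    show "\<zeta> \<in> convex_subdiff X G z"
      unfolding convex_subdiff_def
    proof (intro CollectI ballI)
      fix y assume "y \<in> X"
      then have "G y \<ge> G z + \<zeta> \<bullet> (y - z) - - \<mu> / 2 * (norm (y - z))\<^sup>2"
        using z unfolding weak_subdiff_def by blast
      moreover have "\<mu> / 2 * (norm (y - z))\<^sup>2 \<ge> 0" using \<mu>_pos by simp
      ultimately show "G y \<ge> G z + \<zeta> \<bullet> (y - z)" by simp
    qed
  qed
  ultimately show ?thesis using convex_FG by (auto simp: subdiff_def)
qed

text \<open>
  At the midpoint of y and c, strong convexity makes G at most \<open>- \<mu> / 8\<close> times the
  squared distance of y and c, but G is bounded below by gb. This is the origin of the factor 8 in D.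
\<close>
lemma feasible_dist_le:
  assumes y: "y \<in> X" "G y \<le> 0"
  shows "norm (y - c) \<le> D"
proof -
  define m where "m = (1 - 1/2) *\<^sub>R y + (1/2) *\<^sub>R c"
  have "m \<in> X" unfolding m_def using X y c by (intro convexD_alt) auto
  then have "gb \<le> G m" using lb(2)[of m] s by (simp add: prox_fun_def add_increasing2)
  also have "G m \<le> (1 - 1/2) * G y + 1/2 * G c + (- \<mu>) / 2 * (1/2 * (1 - 1/2) * (norm (y - c))\<^sup>2)"
    unfolding m_def using y c by (intro weakly_convex_onD[OF weakly_convex_FG(2)]) auto
  also have "\<dots> \<le> - (\<mu> / 8 * (norm (y - c))\<^sup>2)"
  proof -
    have "G c \<le> 0" using c by (simp add: prox_fun_def)
    then show ?thesis using y(2) by (simp add: field_simps)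
  qed
  finally have "(norm (y - c))\<^sup>2 \<le> D\<^sup>2"
    unfolding D_sq using \<mu>_pos by (simp add: field_simps)
  then show ?thesis using D_nonneg by (rule power2_le_imp_le)
qed

lemma lagrangian_stationary:
  assumes xh: "xh \<in> X" and l: "l \<ge> 0"
    and min: "\<And>y. y \<in> X \<Longrightarrow> F xh + l * G xh \<le> F y + l * G y"
  obtains a b where "a \<in> clarke_subdiff X f xh" "norm a \<le> M"
    "b \<in> clarke_subdiff X g xh" "norm b \<le> M"
    "- (a + l *\<^sub>R b + ((1 + l) * s) *\<^sub>R (xh - c)) \<in> normal_cone X xh"
proof -
  have "f y + l * g y + (((1 + l) * s) *\<^sub>R (xh - c)) \<bullet> (y - xh) + (1 + l) * s / 2 * (norm (y - xh))\<^sup>2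
      \<ge> f xh + l * g xh" if y: "y \<in> X" for y
  proof -
    have "(norm (y - c))\<^sup>2 = (norm (xh - c))\<^sup>2 + 2 * ((xh - c) \<bullet> (y - xh)) + (norm (y - xh))\<^sup>2"
      using norm_add_sq[of "xh - c" "y - xh"] by simp
    then have "F y + l * G y = f y + l * g y
       + (1 + l) * s / 2 * ((norm (xh - c))\<^sup>2 + 2 * ((xh - c) \<bullet> (y - xh)) + (norm (y - xh))\<^sup>2)"
      unfolding prox_fun_def by (simp add: field_simps)
    moreover have "F xh + l * G xh = f xh + l * g xh + (1 + l) * s / 2 * (norm (xh - c))\<^sup>2"
      unfolding prox_fun_def by (simp add: field_simps)
    ultimately have "f xh + l * g xh + (1 + l) * s / 2 * (norm (xh - c))\<^sup>2 \<le> f y + l * g y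
       + (1 + l) * s / 2 * ((norm (xh - c))\<^sup>2 + 2 * ((xh - c) \<bullet> (y - xh)) + (norm (y - xh))\<^sup>2)"
      using min[OF y] by simp
    then show ?thesis by (simp only: inner_scaleR_left distrib_left) (simp add: mult.assoc)
  qed
  then show thesis
    using stationarity_of_lagrangian_minimizer[OF X(2) cont, of "sf 0" r M "sg 0" xh l
        "((1 + l) * s) *\<^sub>R (xh - c)" "(1 + l) * s / 2"] weak_subgradients sf sg xh l that by blast
qed

text \<open>
  A Slater point follows from the constraint qualification: if G were minimal at a point of its zero set,
  some subgradient there would be minus a normal vector, and the MFCQ direction excludes this.
\<close>
lemma constraint_not_minimal:
  assumes xh: "xh \<in> X" "G xh = 0"
  shows "\<exists>y\<in>X. G y < 0"
proof (rule ccontr)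
  assume no: "\<not> (\<exists>y\<in>X. G y < 0)"
  have min: "g y + 0 * g y + (s *\<^sub>R (xh - c)) \<bullet> (y - xh) + s / 2 * (norm (y - xh))\<^sup>2 \<ge> g xh + 0 * g xh"
    if y: "y \<in> X" for y
  proof -
    have "G xh \<le> G y" using no y xh(2) by (metis not_le)
    then have "g y + 0 * g y + s * ((xh - c) \<bullet> (y - xh)) + s / 2 * (norm (y - xh))\<^sup>2 \<ge> g xh + 0 * g xh"
      using norm_add_sq[of "xh - c" "y - xh"] unfolding prox_fun_def by (simp add: field_simps)
    then show ?thesis by (simp only: inner_scaleR_left)
  qed
  obtain a b where a: "a \<in> clarke_subdiff X g xh"
    and "- (a + 0 *\<^sub>R b + s *\<^sub>R (xh - c)) \<in> normal_cone X xh"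
    by (rule stationarity_of_lagrangian_minimizer[OF X(2) cont(2) cont(2)
          weak_subgradients(2)[where t = 0] _ weak_subgradients(2)[where t = 0] _ xh(1) order_refl min])
      (use sg in auto)
  then have n: "- (a + s *\<^sub>R (xh - c)) \<in> normal_cone X xh" by simp
  obtain w where w: "w \<in> dual_cone (normal_cone X xh)" "\<And>\<zeta>. \<zeta> \<in> subdiff X G xh \<Longrightarrow> \<zeta> \<bullet> (- w) \<le> - \<sigma>"
    using mfcq xh unfolding strong_mfcq_def by fastforce
  have "(a + s *\<^sub>R (xh - c)) \<bullet> (- w) \<le> - \<sigma>" by (intro w prox_subgradient a xh)
  moreover have "w \<bullet> (- (a + s *\<^sub>R (xh - c))) \<ge> 0" using w(1) n unfolding dual_cone_def by blast
  moreover have "w \<bullet> (- (a + s *\<^sub>R (xh - c))) = (a + s *\<^sub>R (xh - c)) \<bullet> (- w)"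
    by (simp only: inner_minus_left inner_minus_right inner_commute[of w])
  ultimately show False using \<sigma> by linarith
qed

text \<open>
  Pairing the stationarity condition with the MFCQ direction cancels the normal vector and leaves \<open>l
  * \<sigma>\<close> below the norm of a subgradient of F, which gives \<open>l \<le> B\<close>. The
  Lagrangian is strongly convex with modulus \<open>(1 + l) * \<mu>\<close>; the factor \<open>1 +
  l\<close> is kept because it later saves one power of \<open>1 + B\<close>.
\<close>
lemma subproblem_solution:
  obtains xh l a b where "xh \<in> X" "G xh \<le> 0" "0 \<le> l" "l \<le> B" "l * G xh = 0"
    "\<And>y. y \<in> X \<Longrightarrow> F xh + (1 + l) * \<mu> / 2 * (norm (y - xh))\<^sup>2 \<le> F y + l * G y"
    "a \<in> clarke_subdiff X f xh" "b \<in> clarke_subdiff X g xh"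
    "- (a + l *\<^sub>R b + ((1 + l) * s) *\<^sub>R (xh - c)) \<in> normal_cone X xh"
proof -
  have contG: "continuous_on X G" unfolding prox_fun_def by (intro continuous_intros cont)
  have Gc: "G c \<le> 0" using c by (simp add: prox_fun_def)
  obtain xh where xh: "xh \<in> X" "G xh \<le> 0" "\<And>y. y \<in> X \<Longrightarrow> G y \<le> 0 \<Longrightarrow> F xh \<le> F y"
    using constrained_prox_minimizer_exists[OF X(1) cont(1) contG lb(1) _ c(1) Gc, of s] s by auto
  obtain y0 where y0: "y0 \<in> X" "G y0 < 0"
    using constraint_not_minimal[OF xh(1)] xh(1,2) by (metis order_le_less)
  obtain l where l: "l \<ge> 0" "l * G xh = 0" "\<And>y. y \<in> X \<Longrightarrow> F xh \<le> F y + l * G y"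
    using lagrange_multiplier[OF convex_FG xh y0] by blast
  have min: "F xh + l * G xh \<le> F y + l * G y" if "y \<in> X" for y
    using l(3)[OF that] l(2) by linarith
  obtain a b where ab: "a \<in> clarke_subdiff X f xh" "norm a \<le> M" "b \<in> clarke_subdiff X g xh"
    "- (a + l *\<^sub>R b + ((1 + l) * s) *\<^sub>R (xh - c)) \<in> normal_cone X xh"
    by (rule lagrangian_stationary[OF xh(1) l(1) min])
  have "l \<le> B"
  proof (cases "G xh = 0")
    case False
    then show ?thesis using l(2) B_nonneg by simp
  next
    case True
    obtain w where w: "w \<in> dual_cone (normal_cone X xh)" "norm w = 1"
      "\<And>\<zeta>. \<zeta> \<in> subdiff X G xh \<Longrightarrow> \<zeta> \<bullet> (- w) \<le> - \<sigma>"
      using mfcq xh(1) True unfolding strong_mfcq_def by fastforce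
    define q where "q = s *\<^sub>R (xh - c)"
    have "w \<bullet> (- (a + l *\<^sub>R b + ((1 + l) * s) *\<^sub>R (xh - c))) \<ge> 0"
      using w(1) ab(4) unfolding dual_cone_def by blast
    also have "a + l *\<^sub>R b + ((1 + l) * s) *\<^sub>R (xh - c) = (a + q) + l *\<^sub>R (b + q)"
      unfolding q_def by (simp add: algebra_simps)
    finally have "l * ((b + q) \<bullet> w) \<le> (a + q) \<bullet> (- w)"
      by (simp add: inner_add_left inner_add_right inner_commute algebra_simps)
    moreover have "l * \<sigma> \<le> l * ((b + q) \<bullet> w)"
      using w(3)[OF prox_subgradient[OF ab(3) xh(1)]] l(1) unfolding q_def
      by (intro mult_left_mono) auto
    moreover have "(a + q) \<bullet> (- w) \<le> M + s * D"
    proof -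
      have "(a + q) \<bullet> (- w) \<le> norm (a + q) * norm (- w)" by (rule norm_cauchy_schwarz)
      also have "\<dots> \<le> norm a + norm q" using w(2) norm_triangle_ineq[of a q] by simp
      also have "norm q \<le> s * D"
        unfolding q_def using feasible_dist_le[OF xh(1,2)] s by simp
      finally show ?thesis using ab(2) by simp
    qed
    ultimately have "l * \<sigma> \<le> M + s * D" by linarith
    then show ?thesis unfolding B_def using \<sigma> by (simp add: pos_le_divide_eq)
  qed
  moreover have "F xh + (1 + l) * \<mu> / 2 * (norm (y - xh))\<^sup>2 \<le> F y + l * G y" if y: "y \<in> X" for y
  proof -
    have "weakly_convex_on ((1 + l) * (- \<mu>)) X (\<lambda>y. F y + l * G y)"
      by (rule weakly_convex_on_lagrangian[OF weakly_convex_FG l(1)])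
    moreover have "0 \<in> convex_subdiff X (\<lambda>y. F y + l * G y) xh"
      using min by (simp add: convex_subdiff_def)
    ultimately have "0 \<in> weak_subdiff ((1 + l) * (- \<mu>)) X (\<lambda>y. F y + l * G y) xh"
      using convex_subdiff_subset_weak_subdiff xh(1) by blast
    then have "F y + l * G y \<ge> F xh + l * G xh + 0 \<bullet> (y - xh) - (1 + l) * (- \<mu>) / 2 * (norm (y - xh))\<^sup>2"
      using y unfolding weak_subdiff_def by blast
    then show ?thesis unfolding l(2) by simp
  qed
  ultimately show thesis using that[of xh l a b] xh l ab by blast
qed

section \<open>One outer step\<close>

text \<open>
  Stationarity of the subproblem is stationarity of the original problem up to the gradients of the
  proximal terms, whose total is \<open>(1 + l) * s * (xh - c)\<close>. Complementary slackness holds for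
  G, and passing to g costs \<open>l * s / 2\<close> times the squared distance, which is controlled as
  \<open>s > 1\<close>.
\<close>
lemma near_kkt_of_small_residual:
  assumes xh: "xh \<in> X" "G xh \<le> 0" and l: "0 \<le> l" "l * G xh = 0"
    and a: "a \<in> clarke_subdiff X f xh" and b: "b \<in> clarke_subdiff X g xh"
    and n: "- (a + l *\<^sub>R b + ((1 + l) * s) *\<^sub>R (xh - c)) \<in> normal_cone X xh"
    and small: "(1 + l) * s * norm (xh - c) \<le> \<epsilon>" and \<epsilon>: "\<epsilon> > 0"
  shows "near_kkt_point X f g \<epsilon> \<epsilon> c"
proof -
  have sub: "a \<in> subdiff X f xh" "b \<in> subdiff X g xh"
    using clarke_subdiff_subset_subdiff cont xh(1) a b by blast+
  have one: "1 \<le> (1 + l) * s" using l(1) s(2) mult_mono[of 1 "1 + l" 1 s] by simp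
  have near: "norm (xh - c) \<le> \<epsilon>"
    using mult_right_mono[OF one, of "norm (xh - c)"] small by simp
  have "infdist (a + l *\<^sub>R b) (uminus ` normal_cone X xh)
      \<le> dist (a + l *\<^sub>R b) (a + l *\<^sub>R b + ((1 + l) * s) *\<^sub>R (xh - c))"
    using n by (intro infdist_le) (metis image_eqI minus_minus)
  also have "\<dots> = (1 + l) * s * norm (xh - c)" using one by (simp add: dist_norm)
  finally have res: "infdist (a + l *\<^sub>R b) (uminus ` normal_cone X xh) \<le> \<epsilon>" using small by simp
  have "l * g xh = - (l * s / 2 * (norm (xh - c))\<^sup>2)"
    using l(2) by (simp add: prox_fun_def field_simps)
  moreover have "l * s / 2 * (norm (xh - c))\<^sup>2 \<ge> 0" using l s by simp
  moreover have "l * s / 2 * (norm (xh - c))\<^sup>2 \<le> ((1 + l) * s) * ((1 + l) * s) * (norm (xh - c))\<^sup>2"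
  proof (rule mult_right_mono)
    have "l * s / 2 \<le> (1 + l) * s * 1" using l s by (simp add: field_simps)
    also have "\<dots> \<le> (1 + l) * s * ((1 + l) * s)" using one by (intro mult_left_mono) auto
    finally show "l * s / 2 \<le> (1 + l) * s * ((1 + l) * s)" .
  qed simp
  moreover have "((1 + l) * s) * ((1 + l) * s) * (norm (xh - c))\<^sup>2 \<le> \<epsilon>\<^sup>2"
  proof -
    have "((1 + l) * s * norm (xh - c))\<^sup>2 \<le> \<epsilon>\<^sup>2" using small one by (intro power_mono) auto
    then show ?thesis by (simp add: power2_eq_square algebra_simps)
  qed
  ultimately have comp: "\<bar>l * g xh\<bar> \<le> \<epsilon>\<^sup>2" by linarith
  have "s / 2 * (norm (xh - c))\<^sup>2 \<ge> 0" using s by simp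
  then have "g xh \<le> 0" using xh(2) unfolding prox_fun_def by linarith
  then have "kkt_point X f g \<epsilon> xh"
    unfolding kkt_point_def using xh(1) sub l(1) res comp by blast
  then show ?thesis
    unfolding near_kkt_point_def using c near by (auto simp: norm_minus_commute)
qed

text \<open>
  The gradients of the proximal terms may be unbounded on X. Their squared norm is \<open>2 * s\<close>
  times the proximal term, that is \<open>2 * s * (G y - g y)\<close>, so it grows at most linearly in the
  constraint value \<open>G y\<close>. This also bounds the subgradients of the objective, since F and G
  have the same proximal term.
\<close>
lemma ssm_solves_subproblem:
  assumes xh: "xh \<in> X" "G xh \<le> 0" and \<tau>: "\<tau> > 0"
    and T: "24 * (3 * M\<^sup>2 - 2 * s * gb) / (\<mu> * \<tau>) \<le> real T" "72 * s\<^sup>2 * D\<^sup>2 / (\<mu> * \<tau>) \<le> (real T)\<^sup>2" "T \<ge> 1"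
  defines "z \<equiv> ssm_out X (prox_grad s sf c) G (prox_grad s sg c) \<tau> T (pg_step r s) c"
  shows "z \<in> X" "F z < F xh + \<tau>" "G z \<le> \<tau>"
proof -
  define A where "A = 3 / 2 * M\<^sup>2 - 6 * s * gb"
  have sgb: "s * gb \<le> 0" using gb_nonpos s by (simp add: mult_nonneg_nonpos)
  have A: "A \<ge> 0" unfolding A_def using sgb zero_le_power2[of M] by (simp only: mult.assoc)
  have sq: "(a + b)\<^sup>2 \<le> 3 / 2 * a\<^sup>2 + 3 * b\<^sup>2" for a b :: real
  proof -
    \<comment> \<open>The weights 3/2 and 3 make the growth rate equal to \<open>6 * s\<close>,
      the constant whose square appears in the step size.\<close>
    have "0 \<le> (a - 2 * b)\<^sup>2 / 2" by simp
    then show ?thesis by (simp add: power2_eq_square algebra_simps)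
  qed
  have grad: "(norm (v + s *\<^sub>R (y - c)))\<^sup>2 \<le> A + 6 * s * h" if y: "y \<in> X" "G y \<le> h" and v: "norm v \<le> M" for v y h
  proof -
    have "s / 2 * (norm (y - c))\<^sup>2 \<le> h - gb"
      using y(2) lb(2)[OF y(1)] unfolding prox_fun_def by linarith
    then have "2 * s * (s / 2 * (norm (y - c))\<^sup>2) \<le> 2 * s * (h - gb)"
      using s by (intro mult_left_mono) auto
    then have dist: "(s * norm (y - c))\<^sup>2 \<le> 2 * s * (h - gb)"
      by (simp add: power2_eq_square algebra_simps)
    have "norm (v + s *\<^sub>R (y - c)) \<le> M + s * norm (y - c)"
      using norm_triangle_ineq[of v "s *\<^sub>R (y - c)"] v s by simp
    then have "(norm (v + s *\<^sub>R (y - c)))\<^sup>2 \<le> (M + s * norm (y - c))\<^sup>2" by (intro power_mono) auto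
    also have "\<dots> \<le> 3 / 2 * M\<^sup>2 + 3 * (s * norm (y - c))\<^sup>2" by (rule sq)
    also have "\<dots> \<le> 3 / 2 * M\<^sup>2 + 3 * (2 * s * (h - gb))" using dist by simp
    also have "\<dots> = A + 6 * s * h" unfolding A_def by (simp add: algebra_simps)
    finally show ?thesis .
  qed
  have budget: "(6 * s)\<^sup>2 / (2 * \<mu>) * (norm (c - xh))\<^sup>2 + 2 * A / \<mu> * real T < \<tau> * (real T * (real T + 1) / 2)"
  proof -
    have \<mu>\<tau>: "\<mu> * \<tau> > 0" using \<mu>_pos \<tau> by simp
    have "(norm (c - xh))\<^sup>2 \<le> D\<^sup>2"
      using feasible_dist_le[OF xh] by (intro power_mono) (auto simp: norm_minus_commute)
    then have "(6 * s)\<^sup>2 / (2 * \<mu>) * (norm (c - xh))\<^sup>2 \<le> (6 * s)\<^sup>2 / (2 * \<mu>) * D\<^sup>2"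
      using \<mu>_pos by (intro mult_left_mono) auto
    also have "\<dots> = 72 * s\<^sup>2 * D\<^sup>2 / (\<mu> * \<tau>) * (\<tau> / 4)"
      using \<mu>_pos \<tau> by (simp add: field_simps)
    also have "\<dots> \<le> (real T)\<^sup>2 * (\<tau> / 4)" using T(2) \<tau> by (intro mult_right_mono) auto
    finally have 1: "(6 * s)\<^sup>2 / (2 * \<mu>) * (norm (c - xh))\<^sup>2 \<le> (real T)\<^sup>2 * (\<tau> / 4)" .
    have "2 * A \<le> 6 * (3 * M\<^sup>2 - 2 * s * gb)" unfolding A_def using sgb by simp
    then have "2 * A / \<mu> \<le> 6 * (3 * M\<^sup>2 - 2 * s * gb) / \<mu>"
      using \<mu>_pos by (intro divide_right_mono) auto
    also have "\<dots> = 24 * (3 * M\<^sup>2 - 2 * s * gb) / (\<mu> * \<tau>) * (\<tau> / 4)"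
      using \<mu>_pos \<tau> by (simp add: field_simps)
    also have "\<dots> \<le> real T * (\<tau> / 4)" using T(1) \<tau> by (intro mult_right_mono) auto
    finally have 2: "2 * A / \<mu> * real T \<le> real T * (\<tau> / 4) * real T" by (intro mult_right_mono) auto
    have "0 < \<tau> * real T" using \<tau> T(3) by simp
    moreover have "\<tau> * (real T * (real T + 1) / 2)
        = (real T)\<^sup>2 * (\<tau> / 4) + real T * (\<tau> / 4) * real T + \<tau> * real T / 2"
      by (simp add: power2_eq_square field_simps)
    ultimately show ?thesis using 1 2 by linarith
  qed
  have step: "pg_step r s t = 2 / (\<mu> * (real t + 2) + (6 * s)\<^sup>2 / (\<mu> * (real t + 1)))" for t
    by (simp add: pg_step_def \<mu>_def power_mult_distrib)
  have dF: "prox_grad s sf c t y \<in> weak_subdiff (- \<mu>) X F y" if "y \<in> X" for t y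
    using weak_subdiff_prox_fun[OF weak_subgradients(1)[OF that]] by (simp add: prox_grad_def \<mu>_def)
  have dG: "prox_grad s sg c t y \<in> weak_subdiff (- \<mu>) X G y" if "y \<in> X" for t y
    using weak_subdiff_prox_fun[OF weak_subgradients(2)[OF that]] by (simp add: prox_grad_def \<mu>_def)
  have nF: "(norm (prox_grad s sf c t y))\<^sup>2 \<le> A + 6 * s * \<tau>" if "y \<in> X" "G y \<le> \<tau>" for t y
    unfolding prox_grad_def using grad[OF that] sf[OF that(1)] by blast
  have nG: "(norm (prox_grad s sg c t y))\<^sup>2 \<le> A + 6 * s * G y" if "y \<in> X" "G y > \<tau>" for t y
    unfolding prox_grad_def using grad[OF that(1) order_refl] sg[OF that(1)] by blast
  have s6: "6 * s \<ge> 0" using s by simp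
  note conv = ssm_convergence[where dF = "prox_grad s sf c" and dG = "prox_grad s sg c",
      OF X(1) convex_FG xh c(1) \<mu>_pos s6 A \<tau> step dF dG nF nG budget, folded z_def]
  show "z \<in> X" "F z < F xh + \<tau>" "G z \<le> \<tau>" using conv by auto
qed

text \<open>
  If c is not nearly stationary, the solution \<open>xh\<close> of the subproblem is at distance at least
  \<open>\<delta>\<close> from c. The approximate solution z is so close to \<open>xh\<close> that it too
  has moved away from c, and then its proximal term is at least \<open>\<tau>\<close>. This pays for the
  infeasibility \<open>\<tau>\<close> of z and for the error \<open>\<tau>\<close> in the objective at
  once: z is exactly feasible and \<open>f z \<le> F xh\<close>. The decrease of f comes from quadratic
  growth at \<open>xh\<close>; the residual is \<open>(1 + l) * s * N\<close> and the growth \<open>(1 +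
  l) * \<mu> / 2 * N\<^sup>2\<close>, so a residual above \<open>\<epsilon>\<close> forces a decrease with
  only one factor \<open>1 + l \<le> 1 + B\<close> in the denominator. The first conclusion says that the
  prescribed number of inner steps is then at least 24, so that rounding it up costs little.
\<close>
lemma ssm_progress:
  assumes not_kkt: "\<not> near_kkt_point X f g \<epsilon> \<epsilon> c" and \<epsilon>: "\<epsilon> > 0"
    and \<tau>: "\<tau> = \<mu> * \<epsilon>\<^sup>2 / (4 * (1 + B)\<^sup>2 * s * (2 * s - r))"
    and T: "24 * (3 * M\<^sup>2 - 2 * s * gb) / (\<mu> * \<tau>) \<le> real T" "72 * s\<^sup>2 * D\<^sup>2 / (\<mu> * \<tau>) \<le> (real T)\<^sup>2"
  defines "z \<equiv> ssm_out X (prox_grad s sf c) G (prox_grad s sg c) \<tau> T (pg_step r s) c"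
  shows "24 \<le> 24 * (3 * M\<^sup>2 - 2 * s * gb) / (\<mu> * \<tau>)"
    and "z \<in> X" "g z \<le> 0" "f z \<le> f c - \<mu> * \<epsilon>\<^sup>2 / (2 * s\<^sup>2 * (1 + B))"
proof -
  obtain xh l a b where xh: "xh \<in> X" "G xh \<le> 0" and l: "0 \<le> l" "l \<le> B" "l * G xh = 0"
    and growth: "\<And>y. y \<in> X \<Longrightarrow> F xh + (1 + l) * \<mu> / 2 * (norm (y - xh))\<^sup>2 \<le> F y + l * G y"
    and ab: "a \<in> clarke_subdiff X f xh" "b \<in> clarke_subdiff X g xh"
      "- (a + l *\<^sub>R b + ((1 + l) * s) *\<^sub>R (xh - c)) \<in> normal_cone X xh"
    using subproblem_solution by metis
  define N where "N = norm (xh - c)"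
  define \<delta> where "\<delta> = \<epsilon> / (s * (1 + B))"
  have sB: "s * (1 + B) > 0" using s B_nonneg by simp
  have \<delta>: "\<delta> > 0" unfolding \<delta>_def using \<epsilon> sB by simp
  have big: "(1 + l) * s * N > \<epsilon>"
    using near_kkt_of_small_residual[OF xh l(1,3) ab _ \<epsilon>] not_kkt unfolding N_def by force
  have N: "N \<ge> \<delta>"
  proof -
    have "\<epsilon> \<le> (1 + l) * s * N" using big by simp
    also have "\<dots> \<le> (1 + B) * s * N" using l s unfolding N_def by (intro mult_right_mono) auto
    finally show ?thesis unfolding \<delta>_def using sB by (simp add: field_simps)
  qed
  have sr: "2 * s - r > 0" using s by simp
  \<comment> \<open>The reason for the value of \<open>\<tau>\<close>: if z were within both \<open>sqrt (2 * \<tau> / \<mu>)\<close> of \<open>xh\<close> and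
    \<open>sqrt (2 * \<tau> / s)\<close> of c, then \<open>xh\<close> would be closer than \<open>\<delta>\<close> to c.\<close>
  have \<tau>\<delta>: "4 * \<tau> * (1 / \<mu> + 1 / s) = \<delta>\<^sup>2"
  proof -
    have "1 / \<mu> + 1 / s = (2 * s - r) / (\<mu> * s)" using \<mu>_pos s by (simp add: \<mu>_def field_simps)
    then show ?thesis
      unfolding \<tau> \<delta>_def using \<mu>_pos s sr B_nonneg
      by (simp add: power_divide power_mult_distrib) (simp add: power2_eq_square)
  qed
  have \<tau>pos: "\<tau> > 0" unfolding \<tau> using \<mu>_pos \<epsilon> s sr B_nonneg by (intro divide_pos_pos mult_pos_pos) auto
  show T24: "24 \<le> 24 * (3 * M\<^sup>2 - 2 * s * gb) / (\<mu> * \<tau>)"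
  proof -
    have "\<delta>\<^sup>2 \<le> D\<^sup>2"
      using N feasible_dist_le[OF xh] \<delta> unfolding N_def by (intro power_mono) auto
    then have "\<mu> * \<delta>\<^sup>2 \<le> - 8 * gb" unfolding D_sq using \<mu>_pos by (simp add: field_simps)
    then have "\<mu> * (4 * \<tau> * (1 / \<mu> + 1 / s)) * s \<le> - 8 * gb * s"
      using s unfolding \<tau>\<delta> by (intro mult_right_mono) auto
    moreover have "\<mu> * (4 * \<tau> * (1 / \<mu> + 1 / s)) * s = 4 * (\<tau> * s) + 4 * (\<mu> * \<tau>)"
      using \<mu>_pos s by (simp add: field_simps)
    moreover have "\<tau> * s > 0" using \<tau>pos s by simp
    moreover have "- 8 * gb * s = 4 * (- 2 * s * gb)" by simp
    ultimately have "\<mu> * \<tau> \<le> 3 * M\<^sup>2 - 2 * s * gb"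
      using zero_le_power2[of M] by linarith
    then show ?thesis using \<mu>_pos \<tau>pos by (simp add: field_simps)
  qed
  have "T \<ge> 1" using T24 T(1) by linarith
  note z = ssm_solves_subproblem[OF xh \<tau>pos T \<open>T \<ge> 1\<close>, folded z_def]
  show "z \<in> X" by (rule z(1))
  define E where "E = norm (z - xh)"
  have "(1 + l) * (\<mu> / 2 * E\<^sup>2) \<le> (1 + l) * \<tau>"
  proof -
    have "(1 + l) * \<mu> / 2 * E\<^sup>2 = (1 + l) * (\<mu> / 2 * E\<^sup>2)" "(1 + l) * \<tau> = \<tau> + l * \<tau>"
      by (simp_all add: distrib_right)
    then show ?thesis
      using growth[OF z(1), folded E_def] z(2) mult_left_mono[OF z(3) l(1)] by linarith
  qed
  then have "\<mu> / 2 * E\<^sup>2 \<le> \<tau>" using l(1) by (subst (asm) mult_le_cancel_left_pos) auto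
  then have E2: "E\<^sup>2 \<le> 2 * \<tau> / \<mu>" using \<mu>_pos by (simp add: field_simps)
  define P where "P = norm (z - c)"
  have tri: "N \<le> E + P" unfolding N_def E_def P_def
    using norm_triangle_ineq[of "xh - z" "z - c"] by (simp add: norm_minus_commute)
  have moved: "s / 2 * P\<^sup>2 \<ge> \<tau>"
  proof (rule ccontr)
    assume "\<not> s / 2 * P\<^sup>2 \<ge> \<tau>"
    then have "P\<^sup>2 < 2 * \<tau> / s" using s by (simp add: field_simps)
    moreover have "(E + P)\<^sup>2 \<le> 2 * E\<^sup>2 + 2 * P\<^sup>2"
      using sum_squares_bound[of E P] by (simp add: power2_sum)
    ultimately have "(E + P)\<^sup>2 < 4 * \<tau> * (1 / \<mu> + 1 / s)"
      using E2 by (simp add: distrib_left)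
    moreover have "\<delta>\<^sup>2 \<le> (E + P)\<^sup>2" using N tri \<delta> by (intro power_mono) auto
    ultimately show False unfolding \<tau>\<delta> by linarith
  qed
  show "g z \<le> 0" using z(3) moved unfolding prox_fun_def P_def by linarith
  have "f z \<le> F xh" using z(2) moved unfolding prox_fun_def P_def by linarith
  also have "F xh \<le> f c - (1 + l) * \<mu> / 2 * N\<^sup>2"
  proof -
    have "F xh + (1 + l) * \<mu> / 2 * N\<^sup>2 \<le> f c + l * g c"
      using growth[OF c(1)] unfolding N_def by (simp add: prox_fun_def norm_minus_commute)
    moreover have "l * g c \<le> 0" using l(1) c(2) by (rule mult_nonneg_nonpos)
    ultimately show ?thesis by linarith
  qed
  also have "\<dots> \<le> f c - \<mu> * \<epsilon>\<^sup>2 / (2 * s\<^sup>2 * (1 + B))"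
  proof -
    have "\<epsilon>\<^sup>2 \<le> ((1 + l) * s * N)\<^sup>2" using big \<epsilon> by (intro power_mono) auto
    also have "\<dots> = (1 + l) * N\<^sup>2 * (s\<^sup>2 * (1 + l))"
      by (simp add: power2_eq_square ac_simps)
    finally have "\<epsilon>\<^sup>2 / (s\<^sup>2 * (1 + l)) \<le> (1 + l) * N\<^sup>2"
      using l(1) s by (subst pos_divide_le_eq) auto
    moreover have "\<epsilon>\<^sup>2 / (s\<^sup>2 * (1 + B)) \<le> \<epsilon>\<^sup>2 / (s\<^sup>2 * (1 + l))"
      using l s by (intro divide_left_mono mult_left_mono mult_pos_pos) auto
    ultimately have "\<mu> / 2 * (\<epsilon>\<^sup>2 / (s\<^sup>2 * (1 + B))) \<le> \<mu> / 2 * ((1 + l) * N\<^sup>2)"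
      using \<mu>_pos by (intro mult_left_mono) auto
    then show ?thesis by (simp add: field_simps)
  qed
  finally show "f z \<le> f c - \<mu> * \<epsilon>\<^sup>2 / (2 * s\<^sup>2 * (1 + B))" .
qed

end

lemma ssm_evals_eq: "ssm_evals Z dF G dG \<tau> T \<alpha> z0 = T"
proof -
  have "ssm_I Z dF G dG \<tau> T \<alpha> z0 \<union> ssm_J Z dF G dG \<tau> T \<alpha> z0 = {..<T}"
    "ssm_I Z dF G dG \<tau> T \<alpha> z0 \<inter> ssm_J Z dF G dG \<tau> T \<alpha> z0 = {}"
    by (auto simp: ssm_I_def ssm_J_def)
  then show ?thesis
    unfolding ssm_evals_def by (metis card_Un_disjoint card_lessThan finite_Un finite_lessThan)
qed

section \<open>Complexity of the proximally guided method\<close>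
theorem theorem3p3:
  fixes X :: "'a::euclidean_space set"
    and f g :: "'a \<Rightarrow> real"
    and sf sg :: "nat \<Rightarrow> nat \<Rightarrow> 'a \<Rightarrow> 'a"
    and x0 :: 'a
    and \<rho> \<rho>h M \<sigma> \<epsilon> f_lb g_lb D B \<tau>_KKT T_KKT \<Lambda>1 \<Lambda>2 \<Lambda>3 :: real
    and T :: nat
    and x :: "nat \<Rightarrow> 'a"
  assumes "closed X" and "convex X"
    \<comment> \<open>(A)\<close>
    and "continuous_on X f" and "continuous_on X g"
    and "weakly_convex_on \<rho> X f" and "weakly_convex_on \<rho> X g"
    \<comment> \<open>(B)\<close>
    and "bdd_below (f ` X)" and "bdd_below (g ` X)"
    and "f_lb = (INF y\<in>X. f y)" and "g_lb = (INF y\<in>X. g y)"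
    \<comment> \<open>(C)\<close>
    and "\<And>k t z. z \<in> X \<Longrightarrow> sf k t z \<in> subdiff X f z \<and> norm (sf k t z) \<le> M"
    and "\<And>k t z. z \<in> X \<Longrightarrow> sg k t z \<in> subdiff X g z \<and> norm (sg k t z) \<le> M"
    \<comment> \<open>(D)\<close>
    and "x0 \<in> X" and "g x0 \<le> 0"
    \<comment> \<open>parameters\<close>
    and "\<rho>h > max \<rho> 1" and "\<epsilon> > 0" and "\<sigma> > 0"
    and "D = sqrt ((- 8 * g_lb) / (\<rho>h - \<rho>))"
    and "B = (M + \<rho>h * D) / \<sigma>"
    and "\<tau>_KKT = ((\<rho>h - \<rho>) * \<epsilon>\<^sup>2) / (4 * (1 + B)\<^sup>2 * \<rho>h * (2 * \<rho>h - \<rho>))"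
    and "\<Lambda>1 = (96 * (1 + B)\<^sup>2 * \<rho>h * (2 * \<rho>h - \<rho>) * (3 * M\<^sup>2 - 2 * \<rho>h * g_lb)) / (\<rho>h - \<rho>)\<^sup>2"
    and "\<Lambda>2 = sqrt ((288 * (1 + B)\<^sup>2 * \<rho>h ^ 3 * (2 * \<rho>h - \<rho>) * D\<^sup>2) / (\<rho>h - \<rho>)\<^sup>2)"
    and "\<Lambda>3 = (4 * (1 + B) * \<rho>h\<^sup>2 * (f x0 - f_lb)) / (\<rho>h - \<rho>)"
    and "T_KKT = max
          ((96 * (1 + B)\<^sup>2 * \<rho>h * (2 * \<rho>h - \<rho>) * (3 * M\<^sup>2 - 2 * \<rho>h * g_lb)) / ((\<rho>h - \<rho>)\<^sup>2 * \<epsilon>\<^sup>2))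
          (sqrt ((288 * (1 + B)\<^sup>2 * \<rho>h ^ 3 * (2 * \<rho>h - \<rho>) * D\<^sup>2) / ((\<rho>h - \<rho>)\<^sup>2 * \<epsilon>\<^sup>2)))"
    \<comment> \<open>the method\<close>
    and "T = nat \<lceil>T_KKT\<rceil>"
    and "x = pgssm X g sf sg \<rho> \<rho>h \<tau>_KKT T x0"
    \<comment> \<open>(E)\<close>
    and "\<And>k. strong_mfcq \<sigma> X (prox_fun \<rho>h g (x k))"
  shows "\<exists>K. real K \<le> \<Lambda>3 / \<epsilon>\<^sup>2
           \<and> near_kkt_point X f g \<epsilon> \<epsilon> (x K)
           \<and> real (pgssm_evals X g sf sg \<rho> \<rho>h \<tau>_KKT T x0 K) \<le> \<Lambda>3 * max \<Lambda>1 (\<Lambda>2 * \<epsilon>) / \<epsilon> ^ 4"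
proof -
  note closed = assms(1) and conv = assms(2) and cont = assms(3,4) and wc = assms(5,6)
    and bdd = assms(7,8) and lbs = assms(9,10) and sf = assms(11) and sg = assms(12)
    and x0 = assms(13,14) and \<rho>h = assms(15) and \<epsilon> = assms(16) and \<sigma> = assms(17)
    and D = assms(18) and B = assms(19) and \<tau> = assms(20) and \<Lambda>1 = assms(21) and \<Lambda>2 = assms(22)
    and \<Lambda>3 = assms(23) and T_KKT = assms(24) and T = assms(25) and x = assms(26) and mfcq = assms(27)
  have lb: "\<And>y. y \<in> X \<Longrightarrow> f_lb \<le> f y" "\<And>y. y \<in> X \<Longrightarrow> g_lb \<le> g y"
    unfolding lbs using bdd by (auto intro: cINF_lower)
  have sub: "proximal_subproblem X f g (sf k) (sg k) \<rho> \<rho>h M \<sigma> f_lb g_lb (x k)"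
    if "x k \<in> X" "g (x k) \<le> 0" for k
    using that closed conv cont wc lb sf sg \<rho>h \<sigma> mfcq by unfold_locales auto
  have x_0: "x 0 = x0" by (simp add: x)
  interpret P0: proximal_subproblem X f g "sf 0" "sg 0" \<rho> \<rho>h M \<sigma> f_lb g_lb "x 0"
    by (rule sub) (use x0 x_0 in auto)
  define \<mu> where "\<mu> = \<rho>h - \<rho>"
  have \<mu>: "\<mu> > 0" using \<rho>h by (simp add: \<mu>_def)
  have h: "\<rho>h > 1" "2 * \<rho>h - \<rho> > 0" using \<rho>h by auto
  have DB: "P0.\<mu> = \<mu>" "P0.D = D" "P0.B = B"
    unfolding P0.\<mu>_def P0.D_def P0.B_def \<mu>_def D B by simp_all
  have B0: "B \<ge> 0" using P0.B_nonneg DB by simp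
  have gb: "\<rho>h * g_lb \<le> 0" using P0.gb_nonpos h by (simp add: mult_nonneg_nonpos)
  have \<tau>pos: "\<tau>_KKT > 0"
    unfolding \<tau> using \<mu> \<epsilon> h B0 by (intro divide_pos_pos mult_pos_pos) (auto simp: \<mu>_def)
  have inv\<tau>: "4 * (1 + B)\<^sup>2 * \<rho>h * (2 * \<rho>h - \<rho>) / (\<mu> * \<epsilon>\<^sup>2) = 1 / \<tau>_KKT"
    unfolding \<tau> \<mu>_def by simp
  \<comment> \<open>The two lower bounds in \<open>T_KKT\<close>, in the shape in which the convergence of the inner method
    uses them.\<close>
  define T1 where "T1 = 24 * (3 * M\<^sup>2 - 2 * \<rho>h * g_lb) / (\<mu> * \<tau>_KKT)"
  define T2 where "T2 = 72 * \<rho>h\<^sup>2 * D\<^sup>2 / (\<mu> * \<tau>_KKT)"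
  have T1: "(96 * (1 + B)\<^sup>2 * \<rho>h * (2 * \<rho>h - \<rho>) * (3 * M\<^sup>2 - 2 * \<rho>h * g_lb)) / ((\<rho>h - \<rho>)\<^sup>2 * \<epsilon>\<^sup>2) = T1"
  proof -
    define Q where "Q = 3 * M\<^sup>2 - 2 * \<rho>h * g_lb"
    have "T1 = 24 * Q / \<mu> * (1 / \<tau>_KKT)" by (simp add: T1_def Q_def)
    also have "\<dots> = (96 * (1 + B)\<^sup>2 * \<rho>h * (2 * \<rho>h - \<rho>) * Q) / (\<mu>\<^sup>2 * \<epsilon>\<^sup>2)"
      unfolding inv\<tau>[symmetric] by (simp add: power2_eq_square ac_simps)
    finally show ?thesis by (simp add: \<mu>_def Q_def)
  qed
  have T2: "(288 * (1 + B)\<^sup>2 * \<rho>h ^ 3 * (2 * \<rho>h - \<rho>) * D\<^sup>2) / ((\<rho>h - \<rho>)\<^sup>2 * \<epsilon>\<^sup>2) = T2"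
  proof -
    have "T2 = 72 * \<rho>h\<^sup>2 * D\<^sup>2 / \<mu> * (1 / \<tau>_KKT)" by (simp add: T2_def)
    also have "\<dots> = (288 * (1 + B)\<^sup>2 * \<rho>h ^ 3 * (2 * \<rho>h - \<rho>) * D\<^sup>2) / (\<mu>\<^sup>2 * \<epsilon>\<^sup>2)"
      unfolding inv\<tau>[symmetric] by (simp add: power2_eq_square power3_eq_cube ac_simps)
    finally show ?thesis by (simp add: \<mu>_def)
  qed
  have T_KKT': "T_KKT = max T1 (sqrt T2)" unfolding T_KKT T1 T2 ..
  have T2_nonneg: "T2 \<ge> 0" unfolding T2_def using \<mu> \<tau>pos by simp
  have "T_KKT \<ge> 0" unfolding T_KKT' using T2_nonneg by (simp add: le_max_iff_disj)
  then have Tle: "T_KKT \<le> real T" "real T \<le> T_KKT + 1" unfolding T by linarith+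
  have TT: "T1 \<le> real T" "T2 \<le> (real T)\<^sup>2"
  proof -
    show "T1 \<le> real T" using Tle(1) unfolding T_KKT' by simp
    have "(sqrt T2)\<^sup>2 \<le> (real T)\<^sup>2" using Tle(1) T2_nonneg unfolding T_KKT' by (intro power_mono) auto
    then show "T2 \<le> (real T)\<^sup>2" using T2_nonneg by simp
  qed
  define dec where "dec = \<mu> * \<epsilon>\<^sup>2 / (2 * \<rho>h\<^sup>2 * (1 + B))"
  have dec: "dec > 0" unfolding dec_def using \<mu> \<epsilon> h B0 by (intro divide_pos_pos mult_pos_pos) auto
  have progress: "24 \<le> T1 \<and> x (Suc k) \<in> X \<and> g (x (Suc k)) \<le> 0 \<and> f (x (Suc k)) \<le> f (x k) - dec"
    if xk: "x k \<in> X" "g (x k) \<le> 0" and not_kkt: "\<not> near_kkt_point X f g \<epsilon> \<epsilon> (x k)" for k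
  proof -
    interpret P: proximal_subproblem X f g "sf k" "sg k" \<rho> \<rho>h M \<sigma> f_lb g_lb "x k"
      by (rule sub[OF xk])
    have DBk: "P.\<mu> = \<mu>" "P.D = D" "P.B = B"
      unfolding P.\<mu>_def P.D_def P.B_def \<mu>_def D B by simp_all
    have "x (Suc k) = ssm_out X (prox_grad \<rho>h (sf k) (x k)) (prox_fun \<rho>h g (x k))
        (prox_grad \<rho>h (sg k) (x k)) \<tau>_KKT T (pg_step \<rho> \<rho>h) (x k)"
      by (simp add: x Let_def)
    then show ?thesis
      using P.ssm_progress[OF not_kkt \<epsilon>, of \<tau>_KKT T, unfolded DBk] \<tau> TT
      unfolding T1_def T2_def dec_def \<mu>_def by simp
  qed
  have descent: "x k \<in> X \<and> g (x k) \<le> 0 \<and> f (x k) \<le> f x0 - real k * dec"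
    if "\<And>j. j < k \<Longrightarrow> \<not> near_kkt_point X f g \<epsilon> \<epsilon> (x j)" for k
    using that
  proof (induction k)
    case 0
    then show ?case using x0 x_0 by simp
  next
    case (Suc k)
    then have "x k \<in> X \<and> g (x k) \<le> 0 \<and> f (x k) \<le> f x0 - real k * dec" by simp
    with progress[of k] Suc.prems[of k] show ?case by (auto simp: algebra_simps)
  qed
  have count: "real k * dec \<le> f x0 - f_lb"
    if "\<And>j. j < k \<Longrightarrow> \<not> near_kkt_point X f g \<epsilon> \<epsilon> (x j)" for k
    using descent[of k, OF that] lb(1)[of "x k"] by auto
  have "\<exists>k. near_kkt_point X f g \<epsilon> \<epsilon> (x k)"
  proof (rule ccontr)
    assume none: "\<nexists>k. near_kkt_point X f g \<epsilon> \<epsilon> (x k)"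
    obtain k where "f x0 - f_lb < real k * dec" using reals_Archimedean3[OF dec] by blast
    then show False using count[of k] none by auto
  qed
  then obtain K where K: "near_kkt_point X f g \<epsilon> \<epsilon> (x K)"
    and first: "\<And>j. j < K \<Longrightarrow> \<not> near_kkt_point X f g \<epsilon> \<epsilon> (x j)"
    using exists_least_iff[of "\<lambda>k. near_kkt_point X f g \<epsilon> \<epsilon> (x k)"] by auto
  have gap: "f x0 - f_lb \<ge> 0" using lb(1)[OF x0(1)] by simp
  have \<Lambda>3': "\<Lambda>3 / \<epsilon>\<^sup>2 = 2 * ((f x0 - f_lb) / dec)"
    unfolding \<Lambda>3 dec_def \<mu>_def by simp
  have K2: "2 * real K \<le> \<Lambda>3 / \<epsilon>\<^sup>2"
    using count[of K, OF first] dec unfolding \<Lambda>3' by (simp add: pos_le_divide_eq)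
  have evals: "pgssm_evals X g sf sg \<rho> \<rho>h \<tau>_KKT T x0 K = K * T"
    by (simp add: pgssm_evals_def ssm_evals_eq Let_def)
  have max_eq: "max \<Lambda>1 (\<Lambda>2 * \<epsilon>) / \<epsilon>\<^sup>2 = T_KKT"
  proof -
    have "\<Lambda>1 / \<epsilon>\<^sup>2 = T1" unfolding T1[symmetric] \<Lambda>1 by simp
    moreover have "\<Lambda>2 * \<epsilon> / \<epsilon>\<^sup>2 = sqrt T2"
    proof -
      have "sqrt T2 = \<Lambda>2 / sqrt (\<epsilon>\<^sup>2)" unfolding T2[symmetric] \<Lambda>2 real_sqrt_divide[symmetric] by simp
      then show ?thesis using \<epsilon> by (simp add: power2_eq_square)
    qed
    ultimately show ?thesis unfolding T_KKT' using \<epsilon> by (simp add: max_divide_distrib_right)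
  qed
  have "real K * real T \<le> \<Lambda>3 / \<epsilon>\<^sup>2 * T_KKT"
  proof (cases "K = 0")
    case True
    then have "0 \<le> \<Lambda>3 / \<epsilon>\<^sup>2 * T_KKT"
      using K2 \<open>T_KKT \<ge> 0\<close> by (intro mult_nonneg_nonneg) auto
    with True show ?thesis by simp
  next
    case False
    \<comment> \<open>Rounding the inner step count up at most doubles it, which the slack in \<open>\<Lambda>3\<close> absorbs.\<close>
    have "24 \<le> T1" using progress[of 0] first[of 0] False x0 x_0 by simp
    then have "real T \<le> 2 * T_KKT" using Tle(2) unfolding T_KKT' by linarith
    then have "real K * real T \<le> real K * (2 * T_KKT)" by (intro mult_left_mono) auto
    also have "\<dots> \<le> \<Lambda>3 / \<epsilon>\<^sup>2 * T_KKT"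
      using mult_right_mono[OF K2 \<open>T_KKT \<ge> 0\<close>] by simp
    finally show ?thesis .
  qed
  also have "\<dots> = \<Lambda>3 * max \<Lambda>1 (\<Lambda>2 * \<epsilon>) / \<epsilon> ^ 4"
    unfolding max_eq[symmetric] by (simp add: power2_eq_square power4_eq_xxxx)
  finally have "real (pgssm_evals X g sf sg \<rho> \<rho>h \<tau>_KKT T x0 K) \<le> \<Lambda>3 * max \<Lambda>1 (\<Lambda>2 * \<epsilon>) / \<epsilon> ^ 4"
    unfolding evals by simp
  then show ?thesis using K K2 by (intro exI[of _ K]) auto
qed

end
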